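(* Let $\kappa$ be a regular uncountable cardinal with $\kappa^{<\kappa}=\kappa$. If $X$ is a strong $\kappa$-Choquet space (Hausdorff, regular) of weight $\le\kappa$, then there is a subtree $T\subseteq{}^{<\kappa}\kappa$ without end nodes and a continuous bijection $f\colon[T]\to X$.
   Context: $[T]$ is the set of branches $x\in{}^\kappa\kappa$ with $x\restriction\alpha\in T$ for all $\alpha<\kappa$, with the subspace topology of ${}^\kappa\kappa$, whose topology is generated by $N_s=\{x: s\subset x\}$ for $s\in{}^{<\kappa}\kappa$. The strong $\kappa$-Choquet game on $X$: players I and II alternate for $\kappa$ rounds; in round $\alpha$, I plays $x_\alpha\in U_\alpha$ with $U_\alpha$ relatively open in $\bigcap_{\beta<\alpha}U_\beta$; II plays $V_\alpha$ relatively open in $U_\alpha$ with $x_\alpha\in V_\alpha$. II wins if $\bigcap_{\alpha<\lambda}U_\alpha\ne\emptyset$ for every limit $\lambda\le\kappa$. $X$ is strong $\kappa$-Choquet if II has a winning strategy. *)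

theory Defs
  imports "HOL-Analysis.Analysis"
begin

unbundle cardinal_syntax

text \<open>
  A cardinal \<open>\<kappa>\<close> is a well-order \<open>r\<close> with \<open>Card_order r\<close>, as in the library. The ordinals below
  \<open>\<kappa>\<close> are the elements of \<open>Field r\<close>, where \<open>a\<close> has the set of predecessors \<open>underS r a\<close>. The
  ordinals up to and including \<open>\<kappa>\<close> are the initial segments of \<open>r\<close> (\<open>ofilter r\<close>), with
  \<open>Field r\<close> in the role of \<open>\<kappa>\<close>. Sequences indexed by an ordinal are partial functions whose
  domain is the corresponding initial segment, so that extension of sequences is \<open>\<subseteq>\<^sub>m\<close>.
\<close>

definition seqs_below :: "'k rel \<Rightarrow> ('k \<rightharpoonup> 'k) set" where
  "seqs_below r = {s. (\<exists>a\<in>Field r. dom s = underS r a) \<and> ran s \<subseteq> Field r}"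

definition full_seqs :: "'k rel \<Rightarrow> ('k \<rightharpoonup> 'k) set" where
  "full_seqs r = {x. dom x = Field r \<and> ran x \<subseteq> Field r}"

definition basic_nbhd :: "'k rel \<Rightarrow> ('k \<rightharpoonup> 'k) \<Rightarrow> ('k \<rightharpoonup> 'k) set" where
  "basic_nbhd r s = {x \<in> full_seqs r. s \<subseteq>\<^sub>m x}"

definition bounded_topology :: "'k rel \<Rightarrow> ('k \<rightharpoonup> 'k) topology" where
  "bounded_topology r = topology_generated_by (basic_nbhd r ` seqs_below r)"

definition subtree :: "'k rel \<Rightarrow> ('k \<rightharpoonup> 'k) set \<Rightarrow> bool" where
  "subtree r T \<longleftrightarrow> T \<subseteq> seqs_below r \<and> (\<forall>t\<in>T. \<forall>s\<in>seqs_below r. s \<subseteq>\<^sub>m t \<longrightarrow> s \<in> T)"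

definition no_end_nodes :: "('k \<rightharpoonup> 'k) set \<Rightarrow> bool" where
  "no_end_nodes T \<longleftrightarrow> (\<forall>t\<in>T. \<exists>u\<in>T. t \<subseteq>\<^sub>m u \<and> t \<noteq> u)"

definition branches :: "'k rel \<Rightarrow> ('k \<rightharpoonup> 'k) set \<Rightarrow> ('k \<rightharpoonup> 'k) set" where
  "branches r T = {x \<in> full_seqs r. \<forall>a\<in>Field r. x |` underS r a \<in> T}"

definition branch_space :: "'k rel \<Rightarrow> ('k \<rightharpoonup> 'k) set \<Rightarrow> ('k \<rightharpoonup> 'k) topology" where
  "branch_space r T = subtopology (bounded_topology r) (branches r T)"

definition weight_le :: "'a topology \<Rightarrow> 'k rel \<Rightarrow> bool" where
  "weight_le X r \<longleftrightarrow>
     (\<exists>\<B>. |\<B>| \<le>o r \<and> (\<forall>V\<in>\<B>. openin X V) \<and>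
          (\<forall>U x. openin X U \<and> x \<in> U \<longrightarrow> (\<exists>V\<in>\<B>. x \<in> V \<and> V \<subseteq> U)))"

text \<open>
  In round \<open>a\<close> of the strong \<open>\<kappa>\<close>-Choquet game player I plays \<open>(x a, U a)\<close> and player II answers
  \<open>V a\<close>. As in the classical strong Choquet game, I must play inside the sets \<open>V b\<close> chosen by II
  in the earlier rounds \<open>b\<close>. At a limit round \<open>a\<close> the intersection of the earlier \<open>V b\<close> equals
  that of the earlier \<open>U b\<close>, and in round 0 it is \<open>UNIV\<close>, so that \<open>U\<close> is then just open in \<open>X\<close>.
\<close>

definition legal_I ::
  "'a topology \<Rightarrow> 'k rel \<Rightarrow> ('k \<Rightarrow> 'a) \<Rightarrow> ('k \<Rightarrow> 'a set) \<Rightarrow> ('k \<Rightarrow> 'a set) \<Rightarrow> 'k \<Rightarrow> bool" where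
  "legal_I X r x U V a \<longleftrightarrow>
     openin (subtopology X (\<Inter>b\<in>underS r a. V b)) (U a) \<and> x a \<in> U a"

definition legal_II ::
  "'a topology \<Rightarrow> ('k \<Rightarrow> 'a) \<Rightarrow> ('k \<Rightarrow> 'a set) \<Rightarrow> ('k \<Rightarrow> 'a set) \<Rightarrow> 'k \<Rightarrow> bool" where
  "legal_II X x U V a \<longleftrightarrow> openin (subtopology X (U a)) (V a) \<and> x a \<in> V a"

text \<open>A strategy for II maps the record of all earlier rounds and I's current move to II's answer.\<close>

type_synonym ('k, 'a) strategy = "('k \<rightharpoonup> 'a \<times> 'a set \<times> 'a set) \<Rightarrow> 'a \<times> 'a set \<Rightarrow> 'a set"

definition history ::
  "'k rel \<Rightarrow> ('k \<Rightarrow> 'a) \<Rightarrow> ('k \<Rightarrow> 'a set) \<Rightarrow> ('k \<Rightarrow> 'a set) \<Rightarrow> 'k \<Rightarrow> ('k \<rightharpoonup> 'a \<times> 'a set \<times> 'a set)" where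
  "history r x U V a = (\<lambda>b. if b \<in> underS r a then Some (x b, U b, V b) else None)"

text \<open>Runs of length \<open>D\<close>, an initial segment of \<open>r\<close>, in which I plays legally and II follows \<open>\<sigma>\<close>.\<close>

definition run_by ::
  "'a topology \<Rightarrow> 'k rel \<Rightarrow> ('k, 'a) strategy \<Rightarrow> 'k set \<Rightarrow>
     ('k \<Rightarrow> 'a) \<Rightarrow> ('k \<Rightarrow> 'a set) \<Rightarrow> ('k \<Rightarrow> 'a set) \<Rightarrow> bool" where
  "run_by X r \<sigma> D x U V \<longleftrightarrow>
     (\<forall>a\<in>D. legal_I X r x U V a \<and> V a = \<sigma> (history r x U V a) (x a, U a))"

definition limit_segment :: "'k rel \<Rightarrow> 'k set \<Rightarrow> bool" where
  "limit_segment r D \<longleftrightarrow>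
     Order_Relation.ofilter r D \<and> D \<noteq> {} \<and> (\<forall>a\<in>D. \<exists>b\<in>D. a \<noteq> b \<and> (a, b) \<in> r)"

text \<open>
  Runs of every length up to \<open>\<kappa>\<close> are considered, since a run in which the intersection is empty at
  some limit below \<open>\<kappa>\<close> is lost by II but cannot be continued by I.
\<close>

definition winning_strategy_II :: "'a topology \<Rightarrow> 'k rel \<Rightarrow> ('k, 'a) strategy \<Rightarrow> bool" where
  "winning_strategy_II X r \<sigma> \<longleftrightarrow>
     (\<forall>D x U V. Order_Relation.ofilter r D \<and> run_by X r \<sigma> D x U V \<longrightarrow>
        (\<forall>a\<in>D. legal_II X x U V a) \<and>
        (limit_segment r D \<longrightarrow> (\<Inter>a\<in>D. U a) \<noteq> {}))"

definition strong_Choquet :: "'k rel \<Rightarrow> 'a topology \<Rightarrow> bool" where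
  "strong_Choquet r X \<longleftrightarrow> (\<exists>\<sigma>. winning_strategy_II X r \<sigma>)"

end

(*
  Refine the topology of X to the one generated by intersections of fewer than kappa open sets. Since
  X is regular and kappa is uncountable, the refined topology has a base of clopen sets; since
  kappa^(<kappa) = kappa, it has a base of size kappa. By playing a fixed point y for fewer than kappa
  rounds against the winning strategy, player I can force the play into any refined neighbourhood of
  y. Hence a refined-clopen set contained in the set still in play splits into at most kappa disjoint
  refined-clopen pieces, each contained in the set still in play after some longer play that has
  shrunk into the piece before. Iterating this along kappa stages gives every point an address in
  kappa^kappa, and T consists of the proper initial segments of addresses. Along a branch of T the
  plays form a run of length kappa, which II wins, so every branch is the address of a point. The
  map from addresses back to points is continuous and well defined because each piece of stage b lies
  in G b or misses K b, where the pairs K b <= G b of closed and open sets separate every point from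
  the complement of every neighbourhood.
*)
theory Submission
  imports Defs
begin

section \<open>Regular uncountable cardinals\<close>

text \<open>\<open>wfrec\<close> truncates the recursive function to the predecessors of
  \<open>b\<close>, and its image on these predecessors does not see the truncation. The set of
  earlier values is enough for constructions by suprema and intersections.\<close>

lemma wf_recursion_image:
  assumes "wf R"
  shows "\<exists>q. \<forall>b. q b = H (q ` {a. (a, b) \<in> R}) b"
proof (intro exI allI)
  fix b
  let ?F = "\<lambda>q b. H (q ` {a. (a, b) \<in> R}) b"
  have "cut (wfrec R ?F) R b ` {a. (a, b) \<in> R} = wfrec R ?F ` {a. (a, b) \<in> R}"
    by (auto simp: cut_apply intro!: image_cong)
  then show "wfrec R ?F b = H (wfrec R ?F ` {a. (a, b) \<in> R}) b"
    by (rule trans[OF wfrec[OF assms] arg_cong])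
qed

locale regular_uncountable =
  fixes r :: "'k rel"
  assumes card_order: "Card_order r" and uncountable: "uncountable (Field r)"
    and regular: "regularCard r"
begin

lemma infinite_Field: "infinite (Field r)"
  using uncountable countable_finite by blast

lemma well_order: "Well_order r"
  using card_order by (rule card_order_on_well_order_on)

lemma wo_rel: "wo_rel r"
  using well_order by unfold_locales

lemma total: "a \<in> Field r \<Longrightarrow> b \<in> Field r \<Longrightarrow> a \<in> underS r b \<or> a = b \<or> b \<in> underS r a"
  using wo_rel.TOTALS[OF wo_rel] unfolding underS_def by blast

lemma underS_trans: "a \<in> underS r b \<Longrightarrow> b \<in> underS r c \<Longrightarrow> a \<in> underS r c"
  using transD[OF wo_rel.TRANS[OF wo_rel]] antisymD[OF wo_rel.ANTISYM[OF wo_rel]]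
  unfolding underS_def by blast

lemma underS_in_Field: "a \<in> underS r b \<Longrightarrow> a \<in> Field r \<and> b \<in> Field r"
  by (auto simp: underS_def Field_def)

lemma ordinal_induct [consumes 1, case_names less]:
  assumes "b \<in> Field r"
    and "\<And>b. b \<in> Field r \<Longrightarrow> (\<And>a. a \<in> underS r b \<Longrightarrow> P a) \<Longrightarrow> P b"
  shows "P b"
proof -
  have "b \<in> Field r \<longrightarrow> P b"
  proof (rule wo_rel.well_order_induct[OF wo_rel])
    fix b
    assume IH: "\<forall>a. a \<noteq> b \<and> (a, b) \<in> r \<longrightarrow> a \<in> Field r \<longrightarrow> P a"
    show "b \<in> Field r \<longrightarrow> P b"
    proof
      assume "b \<in> Field r"
      then show "P b"
        by (rule assms(2)) (use IH in \<open>auto simp: underS_def Field_def\<close>)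
    qed
  qed
  then show ?thesis using assms(1) by blast
qed

lemma ordinal_recursion: "\<exists>q. \<forall>b. q b = H (q ` underS r b) b"
proof -
  have "{a. (a, b) \<in> r - Id} = underS r b" for b
    by (auto simp: underS_def)
  then show ?thesis using wf_recursion_image[OF wo_rel.WF[OF wo_rel], of H] by simp
qed

section \<open>Sets of size less than \<kappa>\<close>

lemma exists_greater:
  assumes "a \<in> Field r"
  obtains b where "b \<in> Field r" "a \<in> underS r b"
  using infinite_Card_order_limit[OF card_order infinite_Field assms]
  by (auto simp: underS_def Field_def)

lemma card_underS: "a \<in> Field r \<Longrightarrow> |underS r a| <o r"
  using card_order by (rule card_of_underS)

lemma card_image_small: "|I| <o r \<Longrightarrow> |f ` I| <o r"
  using card_of_image by (rule ordLeq_ordLess_trans)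

lemma card_UN_small:
  assumes "|I| <o r" "\<And>i. i \<in> I \<Longrightarrow> |A i| <o r"
  shows "|\<Union>i\<in>I. A i| <o r"
  using regularCard_stable[OF card_order infinite_Field regular] assms by (rule stable_UNION)

text \<open>By regularity, a set of size less than \<kappa> is not cofinal.\<close>

lemma bounded_small:
  assumes "A \<subseteq> Field r" "|A| <o r"
  obtains b where "b \<in> Field r" "A \<subseteq> underS r b"
proof -
  have "\<not> cofinal A r"
    using assms regular not_ordLess_ordIso unfolding regularCard_def by blast
  then obtain a where a: "a \<in> Field r" "\<And>b. b \<in> A \<Longrightarrow> \<not> (a \<noteq> b \<and> (a, b) \<in> r)"
    unfolding cofinal_def by blast
  \<comment> \<open>\<open>a\<close> may itself belong to \<open>A\<close>; any greater element is a
    strict bound.\<close>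
  obtain c where c: "c \<in> Field r" "a \<in> underS r c"
    using exists_greater[OF a(1)] .
  have "b \<in> underS r c" if "b \<in> A" for b
    using a c total[of a b] that assms(1) underS_trans[of b a c]
    by (auto simp: underS_def)
  then show thesis using that c by blast
qed

text \<open>Uncountability enters here: it lets countable intersections count as small.\<close>

lemma card_nat_small: "|UNIV :: nat set| <o r"
proof -
  have "\<not> |Field r| \<le>o |UNIV :: nat set|"
    using uncountable by (auto simp flip: card_of_ordLeq simp: countable_def)
  then have "|UNIV :: nat set| <o |Field r|"
    by (simp add: not_ordLeq_iff_ordLess[OF card_of_Well_order card_of_Well_order])
  then show ?thesis
    using card_of_Field_ordIso[OF card_order] by (rule ordLess_ordIso_trans)
qed

text \<open>A well-order of \<open>F\<close> shorter than \<open>r\<close> is isomorphic to a proper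
  initial segment of \<open>r\<close>, and the inverse isomorphism is the required sequence.
  Counting short sequences thus bounds the number of small subsets.\<close>

lemma small_eq_range:
  assumes "F \<subseteq> Field r" "|F| <o r"
  obtains s where "s \<in> seqs_below r" "ran s = F"
proof -
  obtain a where a: "a \<in> Field r" "|F| =o Restr r (underS r a)"
    using ordLess_iff_ordIso_Restr[OF well_order card_of_Well_order, THEN iffD1, OF assms(2)] by blast
  moreover have "Field (Restr r (underS r a)) = underS r a"
    using Field_Restr_ofilter[OF well_order wo_rel.underS_ofilter[OF wo_rel]] .
  ultimately obtain f where f: "bij_betw f F (underS r a)"
    unfolding ordIso_def iso_def by (auto simp: Field_card_of)
  then obtain g where g: "g ` underS r a = F"
    using bij_betw_inv_into bij_betw_imp_surj_on by blast
  show thesis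
  proof
    let ?s = "\<lambda>b. if b \<in> underS r a then Some (g b) else None"
    have "dom ?s = underS r a" by (auto split: if_splits)
    moreover show "ran ?s = F"
      using g by (auto simp: ran_def)
    ultimately show "?s \<in> seqs_below r"
      unfolding seqs_below_def using a(1) assms(1) by blast
  qed
qed

lemma surj_enumeration:
  assumes "|A| \<le>o r" "A \<noteq> {}"
  obtains g where "g ` Field r = A"
proof -
  have "|A| \<le>o |Field r|"
    using assms(1) ordIso_symmetric[OF card_of_Field_ordIso[OF card_order]]
    by (rule ordLeq_ordIso_trans)
  then have "\<exists>g. g ` Field r = A"
    using card_of_ordLeq2[OF assms(2)] by fast
  then show thesis using that by (elim exE)
qed

lemma card_Times_le:
  assumes "|A| \<le>o r" "|B| \<le>o r"
  shows "|A \<times> B| \<le>o r"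
  using card_of_Times_ordLeq_infinite_Field[OF infinite_Field assms card_order] .

end

section \<open>The topology generated by small intersections of open sets\<close>

text \<open>For regular \<kappa> this is the coarsest refinement of \<open>X\<close> in which
  intersections of fewer than \<kappa> open sets are open, described by local bases. The factor
  \<open>topspace X\<close> accounts for the empty family.\<close>

definition additive_topology :: "'k rel \<Rightarrow> 'a topology \<Rightarrow> 'a topology" where
  "additive_topology r X = topology (\<lambda>U. U \<subseteq> topspace X \<and>
     (\<forall>y\<in>U. \<exists>\<F>. |\<F>| <o r \<and> (\<forall>V\<in>\<F>. openin X V) \<and> y \<in> \<Inter>\<F> \<and> topspace X \<inter> \<Inter>\<F> \<subseteq> U))"

definition clopenin :: "'a topology \<Rightarrow> 'a set \<Rightarrow> bool" where
  "clopenin X W \<longleftrightarrow> openin X W \<and> closedin X W"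

context regular_uncountable
begin

lemma finite_small: "finite A \<Longrightarrow> |A| <o r"
  by (rule finite_ordLess_infinite[OF card_of_Well_order well_order])
    (simp_all add: Field_card_of infinite_Field)

lemma card_Un_small: "|A| <o r \<Longrightarrow> |B| <o r \<Longrightarrow> |A \<union> B| <o r"
  using card_UN_small[of "{True, False}" "\<lambda>b. if b then A else B"]
  by (simp add: Un_commute finite_small)

text \<open>Unfolding \<open>topology\<close> requires the predicate to be a topology: the union of
  two small families witnesses a binary intersection, and the witness for one member serves for a
  union.\<close>

lemma openin_additive:
  "openin (additive_topology r X) U \<longleftrightarrow> U \<subseteq> topspace X \<and>
     (\<forall>y\<in>U. \<exists>\<F>. |\<F>| <o r \<and> (\<forall>V\<in>\<F>. openin X V) \<and> y \<in> \<Inter>\<F> \<and> topspace X \<inter> \<Inter>\<F> \<subseteq> U)"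
proof -
  let ?P = "\<lambda>U y. \<exists>\<F>. |\<F>| <o r \<and> (\<forall>V\<in>\<F>. openin X V) \<and> y \<in> \<Inter>\<F> \<and> topspace X \<inter> \<Inter>\<F> \<subseteq> U"
  have Int: "?P (U \<inter> V) y" if PU: "?P U y" and PV: "?P V y" for U V y
  proof -
    obtain \<F> where F: "|\<F>| <o r" "\<forall>V\<in>\<F>. openin X V" "y \<in> \<Inter>\<F>" "topspace X \<inter> \<Inter>\<F> \<subseteq> U"
      using PU by blast
    obtain \<G> where G: "|\<G>| <o r" "\<forall>V\<in>\<G>. openin X V" "y \<in> \<Inter>\<G>" "topspace X \<inter> \<Inter>\<G> \<subseteq> V"
      using PV by blast
    have "|\<F> \<union> \<G>| <o r" using F G card_Un_small by blast
    moreover have "topspace X \<inter> \<Inter>(\<F> \<union> \<G>) \<subseteq> U \<inter> V" using F(4) G(4) by auto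
    ultimately show ?thesis using F(2,3) G(2,3) by (intro exI[of _ "\<F> \<union> \<G>"]) auto
  qed
  have mono: "?P V y" if "?P U y" "U \<subseteq> V" for U V y
    using that by (elim exE) (meson subset_trans)
  have "istopology (\<lambda>U. U \<subseteq> topspace X \<and> (\<forall>y\<in>U. ?P U y))"
    unfolding istopology_def
  proof (intro conjI allI impI)
    fix \<K> assume K: "\<forall>K\<in>\<K>. K \<subseteq> topspace X \<and> (\<forall>y\<in>K. ?P K y)"
    then show "\<Union>\<K> \<subseteq> topspace X" by blast
    show "\<forall>y\<in>\<Union>\<K>. ?P (\<Union>\<K>) y"
    proof
      fix y assume "y \<in> \<Union>\<K>"
      then obtain K' where "K' \<in> \<K>" "y \<in> K'" by blast
      then show "?P (\<Union>\<K>) y" using K by (intro mono[of y K' "\<Union>\<K>"]) (blast | simp)+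
    qed
  next
    fix S T
    assume S: "S \<subseteq> topspace X \<and> (\<forall>y\<in>S. ?P S y)" and T: "T \<subseteq> topspace X \<and> (\<forall>y\<in>T. ?P T y)"
    then show "S \<inter> T \<subseteq> topspace X" by blast
    show "\<forall>y\<in>S \<inter> T. ?P (S \<inter> T) y"
      using S T by (intro ballI Int) simp_all
  qed
  then show ?thesis unfolding additive_topology_def by (simp add: topology_inverse')
qed

lemma openin_imp_openin_additive: "openin X U \<Longrightarrow> openin (additive_topology r X) U"
  unfolding openin_additive
  using finite_small[of "{U}"] by (auto dest: openin_subset intro!: exI[of _ "{U}"])

lemma topspace_additive [simp]: "topspace (additive_topology r X) = topspace X"
proof
  show "topspace (additive_topology r X) \<subseteq> topspace X"
    using openin_topspace[of "additive_topology r X"] unfolding openin_additive by blast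
  show "topspace X \<subseteq> topspace (additive_topology r X)"
    using openin_imp_openin_additive[OF openin_topspace] by (rule openin_subset)
qed

lemma closedin_imp_closedin_additive: "closedin X C \<Longrightarrow> closedin (additive_topology r X) C"
  by (simp add: closedin_def openin_imp_openin_additive)

text \<open>By regularity, fewer than \<kappa> witnessing families, each of size less than \<kappa>,
  have a union of size less than \<kappa>.\<close>

lemma openin_additive_INT:
  assumes I: "|I| <o r" and U: "\<And>i. i \<in> I \<Longrightarrow> openin (additive_topology r X) (U i)"
  shows "openin (additive_topology r X) (topspace X \<inter> (\<Inter>i\<in>I. U i))"
  unfolding openin_additive
proof (intro conjI ballI)
  fix y assume y: "y \<in> topspace X \<inter> (\<Inter>i\<in>I. U i)"
  have "\<forall>i\<in>I. \<exists>\<F>. |\<F>| <o r \<and> (\<forall>V\<in>\<F>. openin X V) \<and> y \<in> \<Inter>\<F> \<and> topspace X \<inter> \<Inter>\<F> \<subseteq> U i"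
    using U y unfolding openin_additive by blast
  then obtain \<F> where F: "\<And>i. i \<in> I \<Longrightarrow> |\<F> i| <o r" "\<And>i V. i \<in> I \<Longrightarrow> V \<in> \<F> i \<Longrightarrow> openin X V"
    "\<And>i. i \<in> I \<Longrightarrow> y \<in> \<Inter>(\<F> i)" "\<And>i. i \<in> I \<Longrightarrow> topspace X \<inter> \<Inter>(\<F> i) \<subseteq> U i"
    by metis
  have "|\<Union>i\<in>I. \<F> i| <o r" using I F(1) by (rule card_UN_small)
  moreover have "topspace X \<inter> \<Inter>(\<Union>i\<in>I. \<F> i) \<subseteq> topspace X \<inter> (\<Inter>i\<in>I. U i)" using F(4) by fastforce
  ultimately show "\<exists>\<F>. |\<F>| <o r \<and> (\<forall>V\<in>\<F>. openin X V) \<and> y \<in> \<Inter>\<F> \<and>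
      topspace X \<inter> \<Inter>\<F> \<subseteq> topspace X \<inter> (\<Inter>i\<in>I. U i)"
    using F(2,3) by (intro exI[of _ "\<Union>i\<in>I. \<F> i"]) auto
qed simp

section \<open>Clopen sets of the additive topology\<close>

lemma clopenin_additive_INT:
  assumes I: "|I| <o r" and W: "\<And>i. i \<in> I \<Longrightarrow> clopenin (additive_topology r X) (W i)"
  shows "clopenin (additive_topology r X) (topspace X \<inter> (\<Inter>i\<in>I. W i))"
  unfolding clopenin_def
proof
  show "openin (additive_topology r X) (topspace X \<inter> (\<Inter>i\<in>I. W i))"
    using I W openin_additive_INT unfolding clopenin_def by blast
  have "closedin (additive_topology r X) (\<Inter>(insert (topspace (additive_topology r X)) (W ` I)))"
    using W unfolding clopenin_def by (intro closedin_Inter) (auto simp del: topspace_additive)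
  then show "closedin (additive_topology r X) (topspace X \<inter> (\<Inter>i\<in>I. W i))"
    by (simp add: INT_insert)
qed

lemma clopenin_diff: "clopenin Y V \<Longrightarrow> clopenin Y W \<Longrightarrow> clopenin Y (V - W)"
  by (simp add: clopenin_def openin_diff closedin_diff)

text \<open>Complements reduce this to intersections. It will allow subtracting all earlier sets of
  a well-ordered cover.\<close>

lemma clopenin_additive_UN:
  assumes I: "|I| <o r" and W: "\<And>i. i \<in> I \<Longrightarrow> clopenin (additive_topology r X) (W i)"
  shows "clopenin (additive_topology r X) (\<Union>i\<in>I. W i)"
proof -
  have top: "clopenin (additive_topology r X) (topspace X)"
    using openin_topspace[of "additive_topology r X"] closedin_topspace[of "additive_topology r X"]
    by (simp add: clopenin_def)
  have "clopenin (additive_topology r X) (topspace X - (topspace X \<inter> (\<Inter>i\<in>I. topspace X - W i)))"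
    using W by (intro clopenin_diff top clopenin_additive_INT I) auto
  moreover have "W i \<subseteq> topspace X" if "i \<in> I" for i
    using W[OF that] openin_subset[of "additive_topology r X"] by (simp add: clopenin_def)
  then have "topspace X - (topspace X \<inter> (\<Inter>i\<in>I. topspace X - W i)) = (\<Union>i\<in>I. W i)"
    by blast
  ultimately show ?thesis by simp
qed

text \<open>Iterated regularity gives open sets \<open>V n\<close> with the closure of
  \<open>V (Suc n)\<close> inside \<open>V n\<close>. Their intersection equals that of the
  closures, so it is closed, and it is open in the additive topology because \<omega> is less than
  \<kappa>.\<close>

lemma regular_imp_clopenin_between:
  assumes reg: "regular_space X" and U: "openin X U" "y \<in> U"
  shows "\<exists>W. clopenin (additive_topology r X) W \<and> y \<in> W \<and> W \<subseteq> U"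
proof -
  have step: "\<exists>V. openin X V \<and> y \<in> V \<and> X closure_of V \<subseteq> O'" if "openin X O'" "y \<in> O'" for O'
  proof -
    have "closedin X (topspace X - O')" "y \<in> topspace X - (topspace X - O')"
      using that openin_subset[OF that(1)] by auto
    then obtain V where "openin X V" "y \<in> V" "disjnt (topspace X - O') (X closure_of V)"
      using reg unfolding regular_space by blast
    then show ?thesis
      using closure_of_subset_topspace[of X V] by (auto simp: disjnt_iff)
  qed
  have "\<exists>V. \<forall>n. (openin X (V n) \<and> y \<in> V n \<and> V n \<subseteq> U) \<and> X closure_of V (Suc n) \<subseteq> V n"
  proof (rule dependent_nat_choice)
    show "\<exists>V. openin X V \<and> y \<in> V \<and> V \<subseteq> U" using U by blast
    fix V n assume "openin X V \<and> y \<in> V \<and> V \<subseteq> U"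
    then show "\<exists>V'. (openin X V' \<and> y \<in> V' \<and> V' \<subseteq> U) \<and> X closure_of V' \<subseteq> V"
      using step[of V] closure_of_subset openin_subset by (metis subset_trans)
  qed
  then obtain V where V: "\<And>n. openin X (V n)" "\<And>n. y \<in> V n" "\<And>n. V n \<subseteq> U"
    "\<And>n. X closure_of V (Suc n) \<subseteq> V n" by blast
  have sub: "V n \<subseteq> topspace X" for n by (rule openin_subset[OF V(1)])
  have "openin (additive_topology r X) (topspace X \<inter> (\<Inter>n. V n))"
    by (intro openin_additive_INT card_nat_small openin_imp_openin_additive V)
  moreover have "closedin (additive_topology r X) (\<Inter>n. X closure_of V n)"
    by (intro closedin_INT closedin_imp_closedin_additive) auto
  moreover have "topspace X \<inter> (\<Inter>n. V n) = (\<Inter>n. V n)" using sub by blast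
  moreover have "(\<Inter>n. X closure_of V n) = (\<Inter>n. V n)"
    using V(4) closure_of_subset[OF sub] by blast
  ultimately have "clopenin (additive_topology r X) (\<Inter>n. V n)" by (simp add: clopenin_def)
  then show ?thesis using V(2,3) by blast
qed

text \<open>Each member of a small witnessing family shrinks to a clopen set around
  \<open>y\<close>, and the intersection of these stays clopen.\<close>

lemma additive_zero_dimensional:
  assumes reg: "regular_space X" and U: "openin (additive_topology r X) U" "y \<in> U"
  shows "\<exists>W. clopenin (additive_topology r X) W \<and> y \<in> W \<and> W \<subseteq> U"
proof -
  obtain \<F> where F: "|\<F>| <o r" "\<forall>V\<in>\<F>. openin X V" "y \<in> \<Inter>\<F>" "topspace X \<inter> \<Inter>\<F> \<subseteq> U"
    using U unfolding openin_additive by blast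
  have "\<forall>V\<in>\<F>. \<exists>W. clopenin (additive_topology r X) W \<and> y \<in> W \<and> W \<subseteq> V"
    using regular_imp_clopenin_between[OF reg] F(2,3) by blast
  then obtain W where W: "\<And>V. V \<in> \<F> \<Longrightarrow> clopenin (additive_topology r X) (W V)"
    "\<And>V. V \<in> \<F> \<Longrightarrow> y \<in> W V" "\<And>V. V \<in> \<F> \<Longrightarrow> W V \<subseteq> V" by metis
  have "clopenin (additive_topology r X) (topspace X \<inter> (\<Inter>V\<in>\<F>. W V))"
    using F(1) W(1) by (rule clopenin_additive_INT)
  moreover have "topspace X \<inter> (\<Inter>V\<in>\<F>. W V) \<subseteq> U" using W(3) F(4) by blast
  moreover have "y \<in> topspace X" using U openin_subset by fastforce
  ultimately show ?thesis using W(2) by (intro exI[of _ "topspace X \<inter> (\<Inter>V\<in>\<F>. W V)"]) blast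
qed

section \<open>Bases and pairs indexed by \<kappa>\<close>

lemma weight_le_basis:
  assumes "weight_le X r"
  obtains e where "\<forall>i\<in>Field r. openin X (e i)"
    "\<forall>U y. openin X U \<longrightarrow> y \<in> U \<longrightarrow> (\<exists>i\<in>Field r. y \<in> e i \<and> e i \<subseteq> U)"
proof -
  from assms obtain \<B> where B0: "|\<B>| \<le>o r \<and> (\<forall>V\<in>\<B>. openin X V) \<and>
      (\<forall>U x. openin X U \<and> x \<in> U \<longrightarrow> (\<exists>V\<in>\<B>. x \<in> V \<and> V \<subseteq> U))"
    unfolding weight_le_def by (elim exE)
  then have B: "|\<B>| \<le>o r" "\<And>V. V \<in> \<B> \<Longrightarrow> openin X V"
    "\<And>U x. openin X U \<Longrightarrow> x \<in> U \<Longrightarrow> \<exists>V\<in>\<B>. x \<in> V \<and> V \<subseteq> U" by simp_all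
  show thesis
  proof (cases "\<B> = {}")
    \<comment> \<open>An empty base forces \<open>X\<close> to have no points, so the constant empty
      family serves.\<close>
    case True
    then show ?thesis using B(3) by (intro that[of "\<lambda>_. {}"]) fastforce+
  next
    case False
    obtain e where e: "e ` Field r = \<B>" using surj_enumeration[OF B(1) False] .
    have "openin X (e i)" if "i \<in> Field r" for i using B(2) e that by blast
    moreover have "\<exists>i\<in>Field r. y \<in> e i \<and> e i \<subseteq> U" if "openin X U" "y \<in> U" for U y
      using B(3)[OF that] unfolding e[symmetric] by blast
    ultimately show ?thesis using that[of e] by simp
  qed
qed

text \<open>Pairs of base sets are enumerated by \<kappa>, and regularity puts the closure of a
  smaller base set inside a given one. The purpose is that a set lying in \<open>G b\<close> or
  missing \<open>K b\<close> is forced into \<open>U\<close> once it contains a point of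
  \<open>K b\<close> and \<open>G b \<subseteq> U\<close>.\<close>

lemma nested_pair_basis:
  assumes "weight_le X r" and reg: "regular_space X"
  obtains K G where "\<forall>b\<in>Field r. closedin X (K b) \<and> openin X (G b) \<and> K b \<subseteq> G b"
    "\<forall>U y. openin X U \<longrightarrow> y \<in> U \<longrightarrow> (\<exists>b\<in>Field r. y \<in> K b \<and> G b \<subseteq> U)"
proof -
  obtain e where basis: "\<forall>i\<in>Field r. openin X (e i)"
    "\<forall>U y. openin X U \<longrightarrow> y \<in> U \<longrightarrow> (\<exists>i\<in>Field r. y \<in> e i \<and> e i \<subseteq> U)"
    using weight_le_basis[OF assms(1)] .
  note e = basis[rule_format]
  have "|Field r \<times> Field r| \<le>o r"
    using card_of_Field_ordIso[OF card_order] ordIso_imp_ordLeq by (intro card_Times_le) blast+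
  moreover have "Field r \<times> Field r \<noteq> {}" using infinite_Field by auto
  ultimately obtain g where g: "g ` Field r = Field r \<times> Field r"
    by (rule surj_enumeration)
  define G where "G b = e (fst (g b))" for b
  \<comment> \<open>The value \<open>{}\<close> for unsuitable pairs keeps \<open>K b\<close> closed
    and inside \<open>G b\<close> in every case.\<close>
  define K where "K b = (if X closure_of e (snd (g b)) \<subseteq> G b then X closure_of e (snd (g b)) else {})" for b
  have "closedin X (K b) \<and> openin X (G b) \<and> K b \<subseteq> G b" if "b \<in> Field r" for b
  proof -
    have "fst (g b) \<in> Field r" using g that by (metis imageI mem_Sigma_iff prod.collapse)
    then show ?thesis by (auto simp: K_def G_def e)
  qed
  moreover have "\<exists>b\<in>Field r. y \<in> K b \<and> G b \<subseteq> U" if U: "openin X U" "y \<in> U" for U y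
  proof -
    obtain i where i: "i \<in> Field r" "y \<in> e i" "e i \<subseteq> U" using e(2)[OF U] by blast
    obtain V C where V: "openin X V" "closedin X C" "y \<in> V" "V \<subseteq> C" "C \<subseteq> e i"
      using reg e(1)[OF i(1)] i(2) unfolding neighbourhood_base_of_closedin[symmetric] neighbourhood_base_of
      by metis
    obtain j where j: "j \<in> Field r" "y \<in> e j" "e j \<subseteq> V" using e(2)[OF V(1,3)] by blast
    obtain b where b: "b \<in> Field r" "g b = (i, j)" using g i(1) j(1)
      by (metis imageE mem_Sigma_iff)
    have "X closure_of e j \<subseteq> C" using j V by (intro closure_of_minimal) auto
    then have "X closure_of e j \<subseteq> G b" using V b by (simp add: G_def)
    moreover have "y \<in> X closure_of e j"
      using j closure_of_subset[OF openin_subset[OF e(1)[OF j(1)]]] by blast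
    ultimately show ?thesis using b i by (intro bexI[of _ b]) (simp_all add: K_def G_def)
  qed
  ultimately show thesis using that[of K G] by simp
qed

text \<open>Every additive neighbourhood contains an intersection of fewer than \<kappa> base sets,
  coded by the range of a short sequence of indices. There are only \<kappa> such sequences.\<close>

lemma additive_basis:
  assumes seqs: "|seqs_below r| =o r" and "weight_le X r"
  obtains B where "\<forall>U y. openin (additive_topology r X) U \<longrightarrow> y \<in> U \<longrightarrow> (\<exists>i\<in>Field r. y \<in> B i \<and> B i \<subseteq> U)"
proof -
  obtain e where basis: "\<forall>i\<in>Field r. openin X (e i)"
    "\<forall>U y. openin X U \<longrightarrow> y \<in> U \<longrightarrow> (\<exists>i\<in>Field r. y \<in> e i \<and> e i \<subseteq> U)"
    using weight_le_basis[OF assms(2)] .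
  note e = basis[rule_format]
  have "seqs_below r \<noteq> {}"
    by (rule small_eq_range[of "{}"]) (auto simp: finite_small)
  with ordIso_imp_ordLeq[OF seqs] obtain g where g: "g ` Field r = seqs_below r"
    by (rule surj_enumeration)
  have "\<exists>i\<in>Field r. y \<in> topspace X \<inter> \<Inter>(e ` ran (g i)) \<and> topspace X \<inter> \<Inter>(e ` ran (g i)) \<subseteq> U"
    if U: "openin (additive_topology r X) U" "y \<in> U" for U y
  proof -
    obtain \<F> where F: "|\<F>| <o r" "\<forall>V\<in>\<F>. openin X V" "y \<in> \<Inter>\<F>" "topspace X \<inter> \<Inter>\<F> \<subseteq> U"
      using U unfolding openin_additive by blast
    have "\<forall>V\<in>\<F>. \<exists>i\<in>Field r. y \<in> e i \<and> e i \<subseteq> V"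
      using F(2,3) e(2) by blast
    then obtain k where k: "\<And>V. V \<in> \<F> \<Longrightarrow> k V \<in> Field r" "\<And>V. V \<in> \<F> \<Longrightarrow> y \<in> e (k V)"
      "\<And>V. V \<in> \<F> \<Longrightarrow> e (k V) \<subseteq> V" by metis
    have "k ` \<F> \<subseteq> Field r" using k(1) by blast
    then obtain s where s: "s \<in> seqs_below r" "ran s = k ` \<F>"
      using small_eq_range card_image_small[OF F(1), of k] by metis
    have "s \<in> g ` Field r" using s(1) g by simp
    then obtain i where i: "i \<in> Field r" "g i = s" by auto
    have "y \<in> topspace X" using U openin_subset by fastforce
    moreover have "topspace X \<inter> \<Inter>(e ` ran s) \<subseteq> U" using F(4) k(3) s(2) by fastforce
    moreover have "y \<in> \<Inter>(e ` ran s)" using k(2) s(2) by simp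
    ultimately show ?thesis using i by (intro bexI[of _ i]) simp_all
  qed
  then show thesis by (intro that[of "\<lambda>i. topspace X \<inter> \<Inter>(e ` ran (g i))"]) simp
qed

end

section \<open>Positions in the Choquet game\<close>

text \<open>For a chain under \<open>\<subseteq>\<^sub>m\<close> this is the union of its members;
  the choice made by \<open>SOME\<close> is immaterial because they agree wherever two are
  defined.\<close>

definition map_Sup :: "('k \<rightharpoonup> 'b) set \<Rightarrow> ('k \<rightharpoonup> 'b)" where
  "map_Sup \<H> b = (if \<exists>h\<in>\<H>. b \<in> dom h then (SOME h. h \<in> \<H> \<and> b \<in> dom h) b else None)"

lemma map_Sup_upper:
  assumes chain: "Complete_Partial_Order.chain (\<subseteq>\<^sub>m) \<H>" and h: "h \<in> \<H>"
  shows "h \<subseteq>\<^sub>m map_Sup \<H>"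
  unfolding map_le_def
proof
  fix b assume b: "b \<in> dom h"
  define g where "g = (SOME g. g \<in> \<H> \<and> b \<in> dom g)"
  have "g \<in> \<H> \<and> b \<in> dom g" unfolding g_def by (rule someI[of _ h]) (use h b in blast)
  moreover from this have "g b = h b" using chainD[OF chain, of g h] h b by (metis map_le_def)
  ultimately show "h b = map_Sup \<H> b" using h b by (auto simp: map_Sup_def simp flip: g_def)
qed

lemma dom_map_Sup:
  assumes "Complete_Partial_Order.chain (\<subseteq>\<^sub>m) \<H>"
  shows "dom (map_Sup \<H>) = (\<Union>h\<in>\<H>. dom h)"
proof
  show "dom (map_Sup \<H>) \<subseteq> (\<Union>h\<in>\<H>. dom h)"
    by (auto simp: map_Sup_def split: if_splits)
  show "(\<Union>h\<in>\<H>. dom h) \<subseteq> dom (map_Sup \<H>)"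
    using map_le_implies_dom_le[OF map_Sup_upper[OF assms]] by blast
qed

lemma (in regular_uncountable) increasing_chain:
  assumes "A \<subseteq> Field r" "\<And>b c. b \<in> A \<Longrightarrow> c \<in> A \<Longrightarrow> c \<in> underS r b \<Longrightarrow> q c \<subseteq>\<^sub>m q b"
  shows "Complete_Partial_Order.chain (\<subseteq>\<^sub>m) (q ` A)"
proof (rule chainI)
  fix f g assume "f \<in> q ` A" "g \<in> q ` A"
  then obtain b c where "b \<in> A" "c \<in> A" "f = q b" "g = q c" by blast
  moreover from this have "b \<in> underS r c \<or> b = c \<or> c \<in> underS r b"
    using assms(1) total by blast
  ultimately show "f \<subseteq>\<^sub>m g \<or> g \<subseteq>\<^sub>m f" using assms(2) by auto
qed

lemma chain_insert_least:
  "Complete_Partial_Order.chain (\<subseteq>\<^sub>m) \<H> \<Longrightarrow> (\<And>g. g \<in> \<H> \<Longrightarrow> h \<subseteq>\<^sub>m g) \<Longrightarrow>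
    Complete_Partial_Order.chain (\<subseteq>\<^sub>m) (insert h \<H>)"
  by (auto simp: chain_def)

type_synonym ('k, 'a) play = "'k \<rightharpoonup> 'a \<times> 'a set \<times> 'a set"

abbreviation point_of :: "('k, 'a) play \<Rightarrow> 'k \<Rightarrow> 'a" where
  "point_of h b \<equiv> fst (the (h b))"

abbreviation move_I :: "('k, 'a) play \<Rightarrow> 'k \<Rightarrow> 'a set" where
  "move_I h b \<equiv> fst (snd (the (h b)))"

abbreviation move_II :: "('k, 'a) play \<Rightarrow> 'k \<Rightarrow> 'a set" where
  "move_II h b \<equiv> snd (snd (the (h b)))"

section \<open>Runs, positions and the set still in play\<close>

locale choquet_game = regular_uncountable r for r :: "'k rel" +
  fixes X :: "'a topology" and \<sigma> :: "('k, 'a) strategy"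
  assumes winning: "winning_strategy_II X r \<sigma>"
begin

abbreviation "X\<^sub>a \<equiv> additive_topology r X"

definition legal_round :: "('k, 'a) play \<Rightarrow> 'k \<Rightarrow> bool" where
  "legal_round h a \<longleftrightarrow> legal_I X r (point_of h) (move_I h) (move_II h) a \<and>
     move_II h a = \<sigma> (history r (point_of h) (move_I h) (move_II h) a) (point_of h a, move_I h a)"

definition is_run :: "('k, 'a) play \<Rightarrow> bool" where
  "is_run h \<longleftrightarrow> Order_Relation.ofilter r (dom h) \<and> (\<forall>a\<in>dom h. legal_round h a)"

definition position :: "('k, 'a) play \<Rightarrow> bool" where
  "position h \<longleftrightarrow> is_run h \<and> dom h \<noteq> Field r"

text \<open>Properness makes plays grow strictly from stage to stage, so that the union over all
  stages has limit length.\<close>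

definition extension ::
  "('k, 'a) play \<Rightarrow> ('k, 'a) play \<Rightarrow> bool" where
  "extension h h' \<longleftrightarrow> position h' \<and> h \<subseteq>\<^sub>m h' \<and> dom h \<noteq> dom h'"

text \<open>For a position this is the set inside which player I has to move next; the factor
  \<open>topspace X\<close> gives the right value for the empty play.\<close>

definition core :: "('k, 'a) play \<Rightarrow> 'a set" where
  "core h = topspace X \<inter> (\<Inter>b\<in>dom h. move_II h b)"

text \<open>A round is judged by its past and its own moves alone, so legality transfers between a
  run and its extensions.\<close>

lemma legal_round_cong:
  assumes "\<And>b. b \<in> underS r a \<Longrightarrow> g b = h b" "g a = h a"
  shows "legal_round g a = legal_round h a"
proof -
  have "history r (point_of g) (move_I g) (move_II g) a = history r (point_of h) (move_I h) (move_II h) a"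
    using assms by (auto simp: history_def fun_eq_iff)
  moreover have "(\<Inter>b\<in>underS r a. move_II g b) = (\<Inter>b\<in>underS r a. move_II h b)"
    using assms by simp
  ultimately show ?thesis using assms by (simp add: legal_round_def legal_I_def)
qed

lemma ofilter_underS_mem: "Order_Relation.ofilter r D \<Longrightarrow> a \<in> D \<Longrightarrow> b \<in> underS r a \<Longrightarrow> b \<in> D"
  by (auto simp: Order_Relation.ofilter_def under_def underS_def)

lemma legal_round_map_le:
  assumes "Order_Relation.ofilter r (dom g)" "g \<subseteq>\<^sub>m h" "a \<in> dom g"
  shows "legal_round g a = legal_round h a"
  using assms ofilter_underS_mem[OF assms(1,3)]
  by (intro legal_round_cong) (auto simp: map_le_def)

lemma is_run_run_by: "is_run h \<Longrightarrow> run_by X r \<sigma> (dom h) (point_of h) (move_I h) (move_II h)"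
  by (simp add: is_run_def run_by_def legal_round_def)

lemma is_run_won:
  assumes "is_run h"
  shows "(\<forall>a\<in>dom h. legal_II X (point_of h) (move_I h) (move_II h) a) \<and>
    (limit_segment r (dom h) \<longrightarrow> (\<Inter>a\<in>dom h. move_I h a) \<noteq> {})"
proof -
  have "Order_Relation.ofilter r (dom h) \<and> run_by X r \<sigma> (dom h) (point_of h) (move_I h) (move_II h)"
    using assms is_run_run_by by (simp add: is_run_def)
  then show ?thesis
    by (rule winning[unfolded winning_strategy_II_def, THEN spec[of _ "dom h"], THEN spec[of _ "point_of h"],
        THEN spec[of _ "move_I h"], THEN spec[of _ "move_II h"], THEN mp])
qed

lemma is_run_legal_II:
  "is_run h \<Longrightarrow> a \<in> dom h \<Longrightarrow> legal_II X (point_of h) (move_I h) (move_II h) a"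
  using is_run_won by blast

lemma move_II_openin: "is_run h \<Longrightarrow> a \<in> dom h \<Longrightarrow> openin (subtopology X (move_I h a)) (move_II h a)"
  using is_run_legal_II by (simp add: legal_II_def)

lemma move_I_openin:
  "is_run h \<Longrightarrow> a \<in> dom h \<Longrightarrow> openin (subtopology X (\<Inter>b\<in>underS r a. move_II h b)) (move_I h a)"
  by (simp add: is_run_def legal_round_def legal_I_def)

lemma move_I_subset:
  "is_run h \<Longrightarrow> a \<in> dom h \<Longrightarrow> move_I h a \<subseteq> topspace X \<inter> (\<Inter>b\<in>underS r a. move_II h b)"
  using openin_subset[OF move_I_openin] by (simp add: topspace_subtopology)

lemma core_antimono:
  assumes "g \<subseteq>\<^sub>m h"
  shows "core h \<subseteq> core g"
proof -
  have "move_II g b = move_II h b" if "b \<in> dom g" for b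
    using assms that by (simp add: map_le_def)
  then show ?thesis using map_le_implies_dom_le[OF assms] unfolding core_def by blast
qed

lemma position_dom:
  assumes "position h"
  obtains a where "a \<in> Field r" "dom h = underS r a"
proof -
  have "Order_Relation.ofilter r (dom h)" using assms by (simp add: position_def is_run_def)
  then have "(\<exists>a\<in>Field r. dom h = underS r a) \<or> dom h = Field r"
    by (simp only: wo_rel.ofilter_underS_Field[OF wo_rel])
  then show thesis using that assms by (auto simp: position_def)
qed

context
  fixes \<H> :: "('k, 'a) play set"
  assumes chain: "Complete_Partial_Order.chain (\<subseteq>\<^sub>m) \<H>"
begin

lemma is_run_map_Sup:
  assumes runs: "\<And>h. h \<in> \<H> \<Longrightarrow> is_run h"
  shows "is_run (map_Sup \<H>)"
  unfolding is_run_def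
proof
  show "Order_Relation.ofilter r (dom (map_Sup \<H>))"
    unfolding dom_map_Sup[OF chain]
    using runs by (intro wo_rel.ofilter_UNION[OF wo_rel]) (simp add: is_run_def)
  show "\<forall>a\<in>dom (map_Sup \<H>). legal_round (map_Sup \<H>) a"
  proof
    fix a assume "a \<in> dom (map_Sup \<H>)"
    then obtain h where h: "h \<in> \<H>" "a \<in> dom h" unfolding dom_map_Sup[OF chain] by blast
    then have "legal_round h a = legal_round (map_Sup \<H>) a"
      using runs map_Sup_upper[OF chain] by (intro legal_round_map_le) (auto simp: is_run_def)
    then show "legal_round (map_Sup \<H>) a" using runs[OF h(1)] h(2) by (simp add: is_run_def)
  qed
qed

lemma core_map_Sup: "core (map_Sup \<H>) = topspace X \<inter> (\<Inter>h\<in>\<H>. core h)"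
proof -
  have "move_II (map_Sup \<H>) b = move_II h b" if "h \<in> \<H>" "b \<in> dom h" for h b
    using map_Sup_upper[OF chain that(1)] that(2) by (simp add: map_le_def)
  then show ?thesis unfolding core_def dom_map_Sup[OF chain] by auto
qed

text \<open>By regularity, fewer than \<kappa> plays of length less than \<kappa> have a union of
  length less than \<kappa>.\<close>

lemma position_map_Sup:
  assumes pos: "\<And>h. h \<in> \<H> \<Longrightarrow> position h" and small: "|\<H>| <o r"
  shows "position (map_Sup \<H>)"
proof -
  have "|dom h| <o r" if "h \<in> \<H>" for h
    using position_dom[OF pos[OF that]] card_underS by metis
  then have "|dom (map_Sup \<H>)| <o r"
    unfolding dom_map_Sup[OF chain] using small by (intro card_UN_small) auto
  then have "dom (map_Sup \<H>) \<noteq> Field r"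
    using card_of_Field_ordIso[OF card_order] not_ordLess_ordIso by metis
  then show ?thesis using is_run_map_Sup pos by (simp add: position_def)
qed

end

section \<open>Steering a play towards a fixed point\<close>

text \<open>Player I plays \<open>y\<close> with \<open>O'\<close> cut down to the set still in
  play; the answer of \<sigma> contains \<open>y\<close> and lies in \<open>O'\<close>.\<close>

lemma position_extend:
  assumes h: "position h" and y: "y \<in> core h" and O': "openin X O'" "y \<in> O'"
  shows "\<exists>h'. extension h h' \<and> y \<in> core h' \<and> core h' \<subseteq> O'"
proof -
  obtain a where a: "a \<in> Field r" "dom h = underS r a" using position_dom[OF h] .
  have run: "is_run h" using h by (simp add: position_def)
  define U where "U = O' \<inter> (\<Inter>b\<in>underS r a. move_II h b)"
  define V where "V = \<sigma> (history r (point_of h) (move_I h) (move_II h) a) (y, U)"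
  define h' where "h' = h(a \<mapsto> (y, U, V))"
  have a_notin: "a \<notin> dom h" using a underS_notIn by metis
  have le: "h \<subseteq>\<^sub>m h'" using a_notin by (auto simp: h'_def map_le_def)
  have dom: "dom h' = insert a (dom h)" by (auto simp: h'_def)
  have under: "dom h' = under r a"
    unfolding dom a(2) using a(1) wo_rel.REFL[OF wo_rel] Refl_under_underS by fastforce
  have agree: "h' b = h b" if "b \<in> underS r a" for b
    using that a_notin a(2) by (auto simp: h'_def)
  have "legal_round h' a"
  proof -
    have "history r (point_of h') (move_I h') (move_II h') a = history r (point_of h) (move_I h) (move_II h) a"
      using agree by (auto simp: history_def fun_eq_iff)
    moreover have "(\<Inter>b\<in>underS r a. move_II h' b) = (\<Inter>b\<in>underS r a. move_II h b)"
      using agree by simp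
    moreover have "h' a = Some (y, U, V)" by (simp add: h'_def)
    moreover have "openin (subtopology X (\<Inter>b\<in>underS r a. move_II h b)) U"
      unfolding U_def openin_subtopology using O' by blast
    moreover have "y \<in> U" using y O' a(2) by (simp add: U_def core_def)
    ultimately show ?thesis by (simp add: legal_round_def legal_I_def V_def)
  qed
  moreover have "legal_round h' b" if "b \<in> dom h" for b
    using legal_round_map_le[OF _ le that] run that by (simp add: is_run_def)
  moreover have "Order_Relation.ofilter r (dom h')"
    unfolding under by (rule wo_rel.under_ofilter[OF wo_rel])
  ultimately have run': "is_run h'" by (auto simp: is_run_def dom)
  \<comment> \<open>The new play has length \<open>a + 1\<close>, which is below \<kappa> because
    \<kappa> is a limit.\<close>
  obtain c where c: "c \<in> Field r" "a \<in> underS r c" using exists_greater[OF a(1)] .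
  then have "c \<notin> dom h'"
    using underS_trans[of c a c] underS_notIn[of c r] by (auto simp: dom a(2))
  then have pos: "position h'" using run' c(1) by (auto simp: position_def)
  have "legal_II X (point_of h') (move_I h') (move_II h') a"
    using is_run_legal_II[OF run'] dom by blast
  then have V: "y \<in> V" "openin (subtopology X U) V" by (simp_all add: legal_II_def h'_def)
  have "core h' = core h \<inter> V"
    using agree by (auto simp: core_def dom a(2)) (auto simp: h'_def)
  moreover have "V \<subseteq> O'" using openin_imp_subset[OF V(2)] by (auto simp: U_def)
  ultimately show ?thesis
    using pos le dom a_notin y V(1) by (intro exI[of _ h']) (auto simp: extension_def)
qed

text \<open>By induction on the round, each set of player II is an open set of \<open>X\<close>
  intersected with fewer than \<kappa> earlier ones. It need not be open in \<open>X\<close>, which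
  is why the additive topology is used.\<close>

lemma core_openin_additive:
  assumes h: "position h"
  shows "openin X\<^sub>a (core h)"
proof -
  have run: "is_run h" using h by (simp add: position_def)
  obtain a where a: "a \<in> Field r" "dom h = underS r a" using position_dom[OF h] .
  have op: "openin X\<^sub>a (move_II h b)" if "b \<in> dom h" for b
  proof -
    have "b \<in> Field r" using that a underS_Field by fast
    then have "b \<in> dom h \<longrightarrow> openin X\<^sub>a (move_II h b)"
    proof (induction b rule: ordinal_induct)
      case (less b)
      show ?case
      proof
        assume b: "b \<in> dom h"
        have "openin X\<^sub>a (topspace X \<inter> (\<Inter>c\<in>underS r b. move_II h c))"
          using less ofilter_underS_mem[of "dom h" b] b run
          by (intro openin_additive_INT card_underS) (auto simp: is_run_def)
        moreover obtain S where S: "openin X S" "move_I h b = S \<inter> (\<Inter>c\<in>underS r b. move_II h c)"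
          using move_I_openin[OF run b] unfolding openin_subtopology by blast
        moreover obtain S' where S': "openin X S'" "move_II h b = S' \<inter> move_I h b"
          using move_II_openin[OF run b] unfolding openin_subtopology by blast
        moreover have "move_II h b = (S' \<inter> S) \<inter> (topspace X \<inter> (\<Inter>c\<in>underS r b. move_II h c))"
          using S S' openin_subset[OF S(1)] by blast
        ultimately show "openin X\<^sub>a (move_II h b)"
          using openin_Int openin_imp_openin_additive by metis
      qed
    qed
    then show ?thesis using that by blast
  qed
  show ?thesis
    unfolding core_def by (intro openin_additive_INT op) (auto simp: a card_underS)
qed

text \<open>An additive neighbourhood contains an intersection of base sets whose indices are
  bounded by some \<open>a\<close> below \<kappa>. Player I repeats \<open>y\<close> through a
  transfinite sequence of rounds, entering the base set of index \<open>b\<close> at step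
  \<open>b\<close>.\<close>

lemma position_extend_into:
  assumes h: "position h" and y: "y \<in> core h" and W: "openin X\<^sub>a W" "y \<in> W"
    and e: "\<And>i. i \<in> Field r \<Longrightarrow> openin X (e i)"
      "\<And>U y. openin X U \<Longrightarrow> y \<in> U \<Longrightarrow> \<exists>i\<in>Field r. y \<in> e i \<and> e i \<subseteq> U"
  shows "\<exists>h'. extension h h' \<and> y \<in> core h' \<and> core h' \<subseteq> W"
proof -
  obtain \<F> where F: "|\<F>| <o r" "\<forall>V\<in>\<F>. openin X V" "y \<in> \<Inter>\<F>" "topspace X \<inter> \<Inter>\<F> \<subseteq> W"
    using W unfolding openin_additive by blast
  have "\<forall>V\<in>\<F>. \<exists>i\<in>Field r. y \<in> e i \<and> e i \<subseteq> V" using F(2,3) e(2) by blast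
  then obtain k where k: "\<And>V. V \<in> \<F> \<Longrightarrow> k V \<in> Field r" "\<And>V. V \<in> \<F> \<Longrightarrow> y \<in> e (k V)"
    "\<And>V. V \<in> \<F> \<Longrightarrow> e (k V) \<subseteq> V" by metis
  obtain a where a: "a \<in> Field r" "k ` \<F> \<subseteq> underS r a"
    using bounded_small[OF _ card_image_small[OF F(1)], of k] k(1) by blast
  have y_top: "y \<in> topspace X" using y by (simp add: core_def)
  \<comment> \<open>Steps whose index codes no member of the family impose no constraint.\<close>
  define N where "N b = (if b \<in> k ` \<F> then e b else topspace X)" for b
  have N: "openin X (N b)" "y \<in> N b" for b
    using e(1) k y_top by (auto simp: N_def)
  \<comment> \<open>The chosen value is meaningful only for positions \<open>g\<close> with
    \<open>y \<in> core g\<close>, which the induction below maintains.\<close>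
  define ext where "ext g b = (SOME g'. extension g g' \<and> y \<in> core g' \<and> core g' \<subseteq> N b)" for g b
  have ext: "extension g (ext g b) \<and> y \<in> core (ext g b) \<and> core (ext g b) \<subseteq> N b"
    if "position g" "y \<in> core g" for g b
    using someI_ex[OF position_extend[OF that N]] unfolding ext_def .
  \<comment> \<open>Inserting \<open>h\<close> makes the recursion start from \<open>h\<close> when
    \<open>b\<close> has no predecessors.\<close>
  obtain q where rec: "\<forall>b. q b = ext (map_Sup (insert h (q ` underS r b))) b"
    using ordinal_recursion[of "\<lambda>S b. ext (map_Sup (insert h S)) b"] by (elim exE)
  note q = rec[rule_format]
  let ?H = "\<lambda>b. insert h (q ` underS r b)"
  have main: "extension h (q b) \<and> y \<in> core (q b) \<and> core (q b) \<subseteq> N b \<and>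
      (\<forall>c\<in>underS r b. q c \<subseteq>\<^sub>m q b)"
    if "b \<in> Field r" for b
    using that
  proof (induction b rule: ordinal_induct)
    case (less b)
    have chain: "Complete_Partial_Order.chain (\<subseteq>\<^sub>m) (?H b)"
    proof (intro chain_insert_least increasing_chain)
      show "underS r b \<subseteq> Field r" using underS_in_Field by blast
      show "q d \<subseteq>\<^sub>m q c" if "c \<in> underS r b" "d \<in> underS r c" for c d
        using less.IH[OF that(1)] that(2) by blast
      show "h \<subseteq>\<^sub>m g" if "g \<in> q ` underS r b" for g
        using that less.IH by (auto simp: extension_def)
    qed
    have small: "|?H b| <o r"
      using card_Un_small[OF finite_small[of "{h}"] card_image_small[OF card_underS[OF less.hyps], of q]] by simp
    have pos: "position (map_Sup (?H b))"
      using less.IH h small by (intro position_map_Sup chain) (auto simp: extension_def)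
    have "y \<in> core (map_Sup (?H b))"
      using less.IH y y_top by (simp add: core_map_Sup[OF chain])
    note x = ext[OF pos this, of b, folded q[of b]]
    have up: "g \<subseteq>\<^sub>m q b" if "g \<in> ?H b" for g
      using map_Sup_upper[OF chain that] x unfolding extension_def by (metis map_le_trans)
    have "dom h \<subseteq> dom (map_Sup (?H b))"
      by (intro map_le_implies_dom_le map_Sup_upper[OF chain]) simp
    moreover have "dom (map_Sup (?H b)) \<subset> dom (q b)"
      using x map_le_implies_dom_le unfolding extension_def by blast
    ultimately have "extension h (q b)" using x up[of h] by (auto simp: extension_def)
    then show ?case using x up by auto
  qed
  have sub: "core (q a) \<subseteq> W"
  proof -
    have "core (q a) \<subseteq> V" if V: "V \<in> \<F>" for V
    proof -
      have "k V \<in> underS r a" using a V by blast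
      then have "core (q a) \<subseteq> core (q (k V))" using main[OF a(1)] core_antimono by blast
      also have "\<dots> \<subseteq> N (k V)" using main k(1)[OF V] by blast
      also have "\<dots> \<subseteq> V" using k(3) V by (auto simp: N_def)
      finally show ?thesis .
    qed
    moreover have "core (q a) \<subseteq> topspace X" by (simp add: core_def)
    ultimately show ?thesis using F(4) by blast
  qed
  show ?thesis using main[OF a(1)] sub by blast
qed

text \<open>The winning condition concerns the sets of player I, while \<open>core\<close> uses
  those of player II. At limit length every set of player II contains a later set of player
  I.\<close>

lemma limit_run_core_nonempty:
  assumes run: "is_run h" and lim: "limit_segment r (dom h)"
  shows "core h \<noteq> {}"
proof -
  have "(\<Inter>a\<in>dom h. move_I h a) \<noteq> {}" using is_run_won[OF run] lim by blast
  then obtain z where "z \<in> (\<Inter>a\<in>dom h. move_I h a)" by (auto simp del: INT_iff)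
  then have z: "z \<in> move_I h a" if "a \<in> dom h" for a using that by simp
  have "z \<in> move_II h a" if a: "a \<in> dom h" for a
  proof -
    obtain b where "b \<in> dom h" "a \<in> underS r b"
      using lim a unfolding limit_segment_def underS_def by blast
    then show ?thesis using move_I_subset[OF run] z by blast
  qed
  moreover have "z \<in> topspace X"
  proof -
    obtain a where "a \<in> dom h" using lim unfolding limit_segment_def by blast
    then show ?thesis using move_I_subset[OF run] z by blast
  qed
  ultimately show ?thesis unfolding core_def by blast
qed

end

section \<open>Addresses of points\<close>

context choquet_game
begin

definition good :: "('k, 'a) play \<Rightarrow> 'a set \<Rightarrow> bool" where
  "good h C \<longleftrightarrow> position h \<and> clopenin X\<^sub>a C \<and> C \<subseteq> core h"

text \<open>Empty pieces are allowed so that every index below \<kappa> can be used. The condition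
  \<open>core (fst (f i)) \<subseteq> C\<close> puts any point surviving the longer play into
  \<open>C\<close>; the last alternative decides the pair \<open>K\<close>, \<open>G\<close> on each
  piece.\<close>

definition splitting ::
  "('k, 'a) play \<Rightarrow> 'a set \<Rightarrow> 'a set \<Rightarrow> 'a set \<Rightarrow>
     ('k \<Rightarrow> ('k, 'a) play \<times> 'a set) \<Rightarrow> bool" where
  "splitting h C K G f \<longleftrightarrow>
     (\<Union>i\<in>Field r. snd (f i)) = C \<and>
     (\<forall>i\<in>Field r. \<forall>j\<in>Field r. i \<noteq> j \<longrightarrow> snd (f i) \<inter> snd (f j) = {}) \<and>
     (\<forall>i\<in>Field r. snd (f i) \<noteq> {} \<longrightarrow>
        good (fst (f i)) (snd (f i)) \<and> extension h (fst (f i)) \<and> core (fst (f i)) \<subseteq> C \<and>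
        (snd (f i) \<subseteq> G \<or> snd (f i) \<inter> K = {}))"

text \<open>Every point of \<open>C\<close> has a clopen piece inside the set left by a longer play
  that has shrunk into \<open>C\<close>. One such piece for each suitable \<open>B i\<close> already
  covers \<open>C\<close>, and subtracting earlier pieces makes them disjoint.\<close>

lemma exists_splitting:
  assumes good: "good h C" and reg: "regular_space X"
    and e: "\<And>i. i \<in> Field r \<Longrightarrow> openin X (e i)"
      "\<And>U y. openin X U \<Longrightarrow> y \<in> U \<Longrightarrow> \<exists>i\<in>Field r. y \<in> e i \<and> e i \<subseteq> U"
    and B: "\<And>U y. openin X\<^sub>a U \<Longrightarrow> y \<in> U \<Longrightarrow> \<exists>i\<in>Field r. y \<in> B i \<and> B i \<subseteq> U"
    and K: "closedin X K" and G: "openin X G" and KG: "K \<subseteq> G"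
  shows "\<exists>f. splitting h C K G f"
proof -
  have h: "position h" "clopenin X\<^sub>a C" "C \<subseteq> core h" using good by (simp_all add: good_def)
  have "\<exists>p. extension h (fst p) \<and> core (fst p) \<subseteq> C \<and> (core (fst p) \<subseteq> G \<or> core (fst p) \<inter> K = {}) \<and>
      clopenin X\<^sub>a (snd p) \<and> y \<in> snd p \<and> snd p \<subseteq> core (fst p)" if y: "y \<in> C" for y
  proof -
    \<comment> \<open>A point outside \<open>G\<close> is outside \<open>K\<close> because
      \<open>K \<subseteq> G\<close>, so \<open>N\<close> is an open neighbourhood of
      \<open>y\<close> in either case.\<close>
    define N where "N = (if y \<in> G then G else topspace X - K)"
    have "y \<in> topspace X" using y h(3) by (auto simp: core_def)
    then have N: "openin X N" "y \<in> N" using G K KG by (auto simp: N_def)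
    have "openin X\<^sub>a (C \<inter> N)"
      using h(2) N(1) openin_imp_openin_additive by (auto simp: clopenin_def)
    moreover have "y \<in> core h" "y \<in> C \<inter> N" using y h(3) N(2) by auto
    ultimately obtain h' where h': "extension h h'" "y \<in> core h'" "core h' \<subseteq> C \<inter> N"
      using position_extend_into[OF h(1) _ _ _ e] by metis
    then have "openin X\<^sub>a (core h')" by (intro core_openin_additive) (simp add: extension_def)
    then obtain W where W: "clopenin X\<^sub>a W" "y \<in> W" "W \<subseteq> core h'"
      using additive_zero_dimensional[OF reg _ h'(2)] by metis
    have "core h' \<subseteq> G \<or> core h' \<inter> K = {}" using h'(3) by (auto simp: N_def split: if_splits)
    then show ?thesis using h' W by (intro exI[of _ "(h', W)"]) auto
  qed
  then obtain p where p: "\<forall>y\<in>C. extension h (fst (p y)) \<and> core (fst (p y)) \<subseteq> C \<and>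
      (core (fst (p y)) \<subseteq> G \<or> core (fst (p y)) \<inter> K = {}) \<and>
      clopenin X\<^sub>a (snd (p y)) \<and> y \<in> snd (p y) \<and> snd (p y) \<subseteq> core (fst (p y))"
    by metis
  \<comment> \<open>One centre per index replaces one piece per point by at most \<kappa>
    pieces.\<close>
  define centre where "centre i = (SOME y. y \<in> C \<and> B i \<subseteq> snd (p y))" for i
  define V where "V i = (if \<exists>y\<in>C. B i \<subseteq> snd (p y) then snd (p (centre i)) else {})" for i
  \<comment> \<open>Fewer than \<kappa> earlier pieces are removed, so \<open>D i\<close> stays
    clopen.\<close>
  define D where "D i = V i - (\<Union>j\<in>underS r i. V j)" for i
  have centre: "centre i \<in> C \<and> B i \<subseteq> snd (p (centre i))" if "\<exists>y\<in>C. B i \<subseteq> snd (p y)" for i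
    unfolding centre_def by (rule someI_ex) (use that in blast)
  have V: "centre i \<in> C \<and> V i = snd (p (centre i))" if "V i \<noteq> {}" for i
    using centre[of i] that unfolding V_def by (auto split: if_splits)
  have V_clopen: "clopenin X\<^sub>a (V i)" for i
    using V[of i] p by (cases "V i = {}") (auto simp: clopenin_def)
  have D_clopen: "clopenin X\<^sub>a (D i)" if "i \<in> Field r" for i
    unfolding D_def by (intro clopenin_diff clopenin_additive_UN V_clopen card_underS that)
  \<comment> \<open>The least index whose \<open>V\<close> contains \<open>y\<close> is the one
    whose \<open>D\<close> contains it.\<close>
  have cover: "\<exists>j\<in>Field r. y \<in> D j" if "i \<in> Field r" "y \<in> V i" for i y
    using that
  proof (induction i rule: ordinal_induct)
    case (less i)
    then show ?case
      using underS_in_Field[of _ i] by (cases "y \<in> (\<Union>j\<in>underS r i. V j)") (auto simp: D_def)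
  qed
  have "splitting h C K G (\<lambda>i. (fst (p (centre i)), D i))"
    unfolding splitting_def fst_conv snd_conv
  proof (intro conjI ballI impI)
    show "(\<Union>i\<in>Field r. D i) = C"
    proof
      have "V i \<subseteq> C" for i
        using V[of i] p by (cases "V i = {}") blast+
      then show "(\<Union>i\<in>Field r. D i) \<subseteq> C" by (auto simp: D_def)
      show "C \<subseteq> (\<Union>i\<in>Field r. D i)"
      proof
        fix y assume y: "y \<in> C"
        have "openin X\<^sub>a (snd (p y))" "y \<in> snd (p y)" using p y by (auto simp: clopenin_def)
        then obtain i where i: "i \<in> Field r" "y \<in> B i" "B i \<subseteq> snd (p y)" using B by blast
        have "\<exists>y\<in>C. B i \<subseteq> snd (p y)" using i(3) y by blast
        then have "y \<in> V i" using centre[of i] i(2) by (auto simp: V_def)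
        then show "y \<in> (\<Union>i\<in>Field r. D i)" using cover[OF i(1)] by blast
      qed
    qed
  next
    fix i j assume "i \<in> Field r" "j \<in> Field r" "i \<noteq> j"
    then show "D i \<inter> D j = {}" using total[of i j] by (auto simp: D_def)
  next
    fix i assume i: "i \<in> Field r" and D: "D i \<noteq> {}"
    have sub: "D i \<subseteq> V i" by (auto simp: D_def)
    then have Vi: "centre i \<in> C" "V i = snd (p (centre i))" using V[of i] D by auto
    note pc = p[rule_format, OF Vi(1)]
    have Dc: "D i \<subseteq> core (fst (p (centre i)))" using sub Vi pc by blast
    show "good (fst (p (centre i))) (D i)"
      using pc Dc D_clopen[OF i] by (simp add: good_def extension_def)
    show "extension h (fst (p (centre i)))" "core (fst (p (centre i))) \<subseteq> C" using pc by simp_all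
    show "D i \<subseteq> G \<or> D i \<inter> K = {}" using pc Dc by blast
  qed
  then show ?thesis by blast
qed

end

section \<open>The scheme of nested pieces and the addresses of points\<close>

text \<open>The splitting depends on the node and the stage, not on a point, so points with the same
  address so far face the same partition. Stage \<open>b\<close> decides the pair
  \<open>K b\<close>, \<open>G b\<close>.\<close>

locale choquet_scheme = choquet_game r X \<sigma>
  for r :: "'k rel" and X :: "'a topology" and \<sigma> :: "('k, 'a) strategy" +
  fixes K G :: "'k \<Rightarrow> 'a set"
    and split :: "('k, 'a) play \<times> 'a set \<Rightarrow> 'k \<Rightarrow> 'k \<Rightarrow> ('k, 'a) play \<times> 'a set"
  assumes Hausdorff: "Hausdorff_space X"
    and KG: "openin X U \<Longrightarrow> y \<in> U \<Longrightarrow> \<exists>b\<in>Field r. y \<in> K b \<and> G b \<subseteq> U"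
    and split: "good (fst s) (snd s) \<Longrightarrow> b \<in> Field r \<Longrightarrow> splitting (fst s) (snd s) (K b) (G b) (split s b)"
begin

text \<open>Earlier nodes combine into the supremum of their plays and the intersection of their
  pieces. With no earlier nodes this is the empty play and the whole space.\<close>

definition join :: "(('k, 'a) play \<times> 'a set) set \<Rightarrow> ('k, 'a) play \<times> 'a set" where
  "join S = (map_Sup (fst ` S), topspace X \<inter> \<Inter>(snd ` S))"

definition piece :: "'a \<Rightarrow> ('k, 'a) play \<times> 'a set \<Rightarrow> 'k \<Rightarrow> 'k" where
  "piece y s b = (SOME i. i \<in> Field r \<and> y \<in> snd (split s b i))"

definition stage :: "'a \<Rightarrow> 'k \<Rightarrow> ('k, 'a) play \<times> 'a set" where
  "stage y = (SOME q. \<forall>b. q b = split (join (q ` underS r b)) b (piece y (join (q ` underS r b)) b))"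

definition before :: "'a \<Rightarrow> 'k \<Rightarrow> ('k, 'a) play \<times> 'a set" where
  "before y b = join (stage y ` underS r b)"

definition address :: "'a \<Rightarrow> 'k \<rightharpoonup> 'k" where
  "address y b = (if b \<in> Field r then Some (piece y (before y b) b) else None)"

lemma stage_eq: "stage y b = split (before y b) b (piece y (before y b) b)"
proof -
  have "\<exists>q. \<forall>b. q b = split (join (q ` underS r b)) b (piece y (join (q ` underS r b)) b)"
    using ordinal_recursion[of "\<lambda>S b. split (join S) b (piece y (join S) b)"] .
  then have "\<forall>b. stage y b = split (join (stage y ` underS r b)) b (piece y (join (stage y ` underS r b)) b)"
    unfolding stage_def by (rule someI_ex)
  then show ?thesis unfolding before_def by (rule spec)
qed

lemma before_cong: "(\<And>c. c \<in> underS r b \<Longrightarrow> stage y c = stage z c) \<Longrightarrow> before y b = before z b"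
  unfolding before_def by (metis image_cong)

lemma before_upper: "c \<in> underS r b \<Longrightarrow> snd (before y b) \<subseteq> snd (stage y c)"
  by (auto simp: before_def join_def)

context
  fixes y b
  assumes good: "good (fst (before y b)) (snd (before y b))" and y: "y \<in> snd (before y b)"
    and b: "b \<in> Field r"
begin

lemma piece_properties:
  "piece y (before y b) b \<in> Field r \<and> y \<in> snd (split (before y b) b (piece y (before y b) b))"
proof -
  have "(\<Union>i\<in>Field r. snd (split (before y b) b i)) = snd (before y b)"
    using split[OF good b] by (simp add: splitting_def)
  then have "\<exists>i. i \<in> Field r \<and> y \<in> snd (split (before y b) b i)" using y by blast
  then show ?thesis unfolding piece_def by (rule someI_ex)
qed

lemma mem_stage: "y \<in> snd (stage y b)"
  using piece_properties by (simp add: stage_eq)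

lemma stage_properties:
  "good (fst (stage y b)) (snd (stage y b)) \<and> extension (fst (before y b)) (fst (stage y b)) \<and>
    core (fst (stage y b)) \<subseteq> snd (before y b) \<and>
    (snd (stage y b) \<subseteq> G b \<or> snd (stage y b) \<inter> K b = {})"
proof -
  have "snd (split (before y b) b (piece y (before y b) b)) \<noteq> {}" using piece_properties by blast
  with split[OF good b, unfolded splitting_def, THEN conjunct2, THEN conjunct2, rule_format]
    piece_properties[THEN conjunct1]
  show ?thesis unfolding stage_eq[of y b] by simp
qed

end

text \<open>The clauses are proved together: the inclusions make the earlier plays a chain, and
  since fewer than \<kappa> stages precede \<open>b\<close>, the supremum is again a position and
  the intersection of the pieces is again clopen.\<close>

lemma scheme:
  assumes y: "y \<in> topspace X" and "b \<in> Field r"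
  shows "good (fst (before y b)) (snd (before y b)) \<and> y \<in> snd (before y b) \<and>
    (\<forall>c\<in>underS r b. fst (stage y c) \<subseteq>\<^sub>m fst (before y b))"
  using assms(2)
proof (induction b rule: ordinal_induct)
  case (less b)
  let ?S = "fst ` stage y ` underS r b"
  have Field: "c \<in> Field r" if "c \<in> underS r b" for c using that underS_in_Field by blast
  have props: "good (fst (stage y c)) (snd (stage y c))" "y \<in> snd (stage y c)"
    "extension (fst (before y c)) (fst (stage y c))" if "c \<in> underS r b" for c
    using less.IH[OF that] stage_properties mem_stage Field[OF that] by blast+
  have chain: "Complete_Partial_Order.chain (\<subseteq>\<^sub>m) ?S"
    unfolding image_image
  proof (rule increasing_chain)
    show "underS r b \<subseteq> Field r" using Field by blast
    show "fst (stage y d) \<subseteq>\<^sub>m fst (stage y c)" if "c \<in> underS r b" "d \<in> underS r c" for c d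
      using less.IH[OF that(1)] that(2) props(3)[OF that(1)]
      by (auto simp: extension_def intro: map_le_trans[of _ "fst (before y c)"])
  qed
  have small: "|stage y ` underS r b| <o r" by (intro card_image_small card_underS less.hyps)
  have fst: "fst (before y b) = map_Sup ?S" and snd: "snd (before y b) = topspace X \<inter> (\<Inter>s\<in>stage y ` underS r b. snd s)"
    by (simp_all add: before_def join_def)
  have "position (map_Sup ?S)"
    using props(1) by (intro position_map_Sup chain card_image_small[OF small]) (auto simp: good_def)
  moreover have "clopenin X\<^sub>a (snd (before y b))"
    unfolding snd using props(1) by (intro clopenin_additive_INT small) (auto simp: good_def)
  moreover have "snd (before y b) \<subseteq> core (fst (before y b))"
    unfolding fst snd core_map_Sup[OF chain] using props(1) by (auto simp: good_def)
  moreover have "y \<in> snd (before y b)" unfolding snd using y props(2) by auto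
  moreover have "fst (stage y c) \<subseteq>\<^sub>m fst (before y b)" if "c \<in> underS r b" for c
    unfolding fst using that by (intro map_Sup_upper[OF chain]) blast
  ultimately show ?case by (simp add: good_def fst)
qed

context
  fixes y b
  assumes yb: "y \<in> topspace X" "b \<in> Field r"
begin

lemma stage_mem: "y \<in> snd (stage y b)"
  using scheme[OF yb] mem_stage yb(2) by blast

lemma stage_extension: "extension (fst (before y b)) (fst (stage y b))"
  and stage_good: "good (fst (stage y b)) (snd (stage y b))"
  and stage_core: "core (fst (stage y b)) \<subseteq> snd (before y b)"
  and stage_small: "snd (stage y b) \<subseteq> G b \<or> snd (stage y b) \<inter> K b = {}"
  using scheme[OF yb] stage_properties[of y b] yb(2) by blast+

lemma piece_in_Field: "piece y (before y b) b \<in> Field r"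
  using scheme[OF yb] piece_properties yb(2) by blast

lemma stage_increasing:
  assumes "c \<in> underS r b"
  shows "fst (stage y c) \<subseteq>\<^sub>m fst (stage y b)" "dom (fst (stage y c)) \<subset> dom (fst (stage y b))"
proof -
  have le: "fst (stage y c) \<subseteq>\<^sub>m fst (before y b)" using scheme[OF yb] assms by blast
  have "dom (fst (before y b)) \<subset> dom (fst (stage y b))"
    using stage_extension map_le_implies_dom_le unfolding extension_def by blast
  then show "dom (fst (stage y c)) \<subset> dom (fst (stage y b))"
    using map_le_implies_dom_le[OF le] by blast
  show "fst (stage y c) \<subseteq>\<^sub>m fst (stage y b)"
    using map_le_trans[OF le] stage_extension by (simp add: extension_def)
qed

end

text \<open>Stages can be decoded from addresses: equal earlier stages give the same node, and equal
  indices then select the same piece.\<close>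

lemma stage_cong:
  assumes "b \<in> Field r" "address y b = address z b" "\<And>c. c \<in> underS r b \<Longrightarrow> address y c = address z c"
  shows "stage y b = stage z b"
  using assms
proof (induction b rule: ordinal_induct)
  case (less b)
  have "before y b = before z b"
    using less underS_trans by (intro before_cong) blast
  moreover from this have "piece y (before y b) b = piece z (before z b) b"
    using less.prems(1) less.hyps by (simp add: address_def)
  ultimately show ?case by (simp add: stage_eq)
qed

text \<open>The pieces of a splitting are disjoint, so a point in the piece chosen by
  \<open>y\<close> chooses the same index.\<close>

lemma address_eqI:
  assumes y: "y \<in> topspace X" and z: "z \<in> topspace X" and b: "b \<in> Field r"
    and eq: "\<And>c. c \<in> underS r b \<Longrightarrow> stage z c = stage y c" and mem: "z \<in> snd (stage y b)"
  shows "address z b = address y b \<and> stage z b = stage y b"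
proof -
  have before: "before z b = before y b" using eq by (rule before_cong)
  have "z \<in> snd (split (before y b) b (piece y (before y b) b))" using mem by (simp add: stage_eq)
  moreover have "z \<in> snd (split (before y b) b (piece z (before y b) b))"
    using stage_mem[OF z b] by (simp add: stage_eq before)
  moreover have "splitting (fst (before y b)) (snd (before y b)) (K b) (G b) (split (before y b) b)"
    using scheme[OF y b] split b by blast
  ultimately have "piece z (before y b) b = piece y (before y b) b"
    using piece_in_Field[OF y b] piece_in_Field[OF z b] unfolding splitting_def before by blast
  then show ?thesis by (simp add: address_def stage_eq before)
qed

text \<open>Take \<open>b\<close> with \<open>y \<in> K b\<close> and
  \<open>G b \<subseteq> U\<close>. The piece of stage \<open>b\<close> contains \<open>y\<close>,
  hence meets \<open>K b\<close>, hence lies in \<open>G b\<close>.\<close>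

lemma stage_within:
  assumes "openin X U" "y \<in> U"
  shows "\<exists>b\<in>Field r. snd (stage y b) \<subseteq> U"
proof -
  obtain b where b: "b \<in> Field r" "y \<in> K b" "G b \<subseteq> U" using KG[OF assms] by blast
  have "y \<in> topspace X" using assms openin_subset by blast
  then show ?thesis using stage_small[OF _ b(1)] stage_mem[OF _ b(1)] b by blast
qed

section \<open>Injectivity of addresses\<close>

lemma address_inj: "inj_on address (topspace X)"
proof (rule inj_onI, rule ccontr)
  fix y z assume yz: "y \<in> topspace X" "z \<in> topspace X" "address y = address z" "y \<noteq> z"
  then obtain U V where U: "openin X U" "openin X V" "y \<in> U" "z \<in> V" "disjnt U V"
    using Hausdorff unfolding Hausdorff_space_def by metis
  obtain b where b: "b \<in> Field r" "snd (stage y b) \<subseteq> U" using stage_within[OF U(1,3)] by blast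
  have "stage y b = stage z b" using b(1) yz(3) by (intro stage_cong) simp_all
  then have "z \<in> U" using stage_mem[OF yz(2) b(1)] b(2) by auto
  then show False using U by (auto simp: disjnt_iff)
qed

lemma address_in_full_seqs: "y \<in> topspace X \<Longrightarrow> address y \<in> full_seqs r"
  using piece_in_Field by (auto simp: full_seqs_def address_def ran_def dom_def split: if_splits)

section \<open>The tree of initial segments of addresses\<close>

definition address_tree :: "('k \<rightharpoonup> 'k) set" where
  "address_tree = {address y |` underS r a | y a. y \<in> topspace X \<and> a \<in> Field r}"

lemma dom_address_restrict: "dom (address y |` underS r a) = underS r a"
  using underS_in_Field by (auto simp: address_def restrict_map_def dom_def split: if_splits)

lemma address_tree_subset: "address_tree \<subseteq> seqs_below r"
proof
  fix t assume "t \<in> address_tree"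
  then obtain y a where ya: "t = address y |` underS r a" "y \<in> topspace X" "a \<in> Field r"
    unfolding address_tree_def by blast
  have "ran t \<subseteq> ran (address y)" unfolding ya(1) by (auto simp: ran_def restrict_map_def)
  then show "t \<in> seqs_below r"
    using address_in_full_seqs[OF ya(2)] ya dom_address_restrict
    unfolding seqs_below_def full_seqs_def by blast
qed

lemma subtree_address_tree: "subtree r address_tree"
  unfolding subtree_def
proof (intro conjI address_tree_subset ballI impI)
  fix t s assume "t \<in> address_tree" and s: "s \<in> seqs_below r" "s \<subseteq>\<^sub>m t"
  then obtain y a where ya: "t = address y |` underS r a" "y \<in> topspace X" "a \<in> Field r"
    unfolding address_tree_def by blast
  obtain c where c: "c \<in> Field r" "dom s = underS r c" using s(1) unfolding seqs_below_def by blast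
  have sub: "underS r c \<subseteq> underS r a"
    using map_le_implies_dom_le[OF s(2)] unfolding c ya(1) dom_address_restrict .
  have "s = address y |` underS r c"
  proof
    fix b
    show "s b = (address y |` underS r c) b"
    proof (cases "b \<in> underS r c")
      case True
      then have "s b = t b" using s(2) c(2) unfolding map_le_def by blast
      then show ?thesis using True sub unfolding ya(1) by (auto simp: restrict_map_def)
    next
      case False
      then show ?thesis using c(2) by (auto simp: restrict_map_def)
    qed
  qed
  then show "s \<in> address_tree" using ya c unfolding address_tree_def by blast
qed

lemma no_end_nodes_address_tree: "no_end_nodes address_tree"
  unfolding no_end_nodes_def
proof
  fix t assume "t \<in> address_tree"
  then obtain y a where ya: "t = address y |` underS r a" "y \<in> topspace X" "a \<in> Field r"
    unfolding address_tree_def by blast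
  obtain b where b: "b \<in> Field r" "a \<in> underS r b" using exists_greater[OF ya(3)] .
  let ?u = "address y |` underS r b"
  have "underS r a \<subseteq> underS r b" using underS_trans b(2) by blast
  then have "t \<subseteq>\<^sub>m ?u" unfolding ya(1) by (auto simp: map_le_def restrict_map_def split: if_splits)
  moreover have "dom t \<noteq> dom ?u"
    unfolding ya(1) dom_address_restrict using b(2) underS_notIn[of a r] by blast
  moreover have "?u \<in> address_tree" using ya b unfolding address_tree_def by blast
  ultimately show "\<exists>u\<in>address_tree. t \<subseteq>\<^sub>m u \<and> t \<noteq> u" by metis
qed

section \<open>Branches are exactly the addresses of points\<close>

lemma address_in_branches: "y \<in> topspace X \<Longrightarrow> address y \<in> branches r address_tree"
  using address_in_full_seqs unfolding branches_def address_tree_def by blast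

text \<open>The points realizing initial segments of \<open>x\<close> share their stages, whose
  plays unite to a run of limit length. Since player II wins it, some \<open>z\<close> survives, and
  \<open>z\<close> lies in every piece along \<open>x\<close>.\<close>

lemma branches_subset: "branches r address_tree \<subseteq> address ` topspace X"
proof
  fix x assume x: "x \<in> branches r address_tree"
  \<comment> \<open>The node is taken longer than \<open>c\<close>, so that the agreement with
    \<open>x\<close> includes \<open>c\<close> itself.\<close>
  have "\<exists>y. y \<in> topspace X \<and> address y c = x c \<and> (\<forall>d\<in>underS r c. address y d = x d)" if c: "c \<in> Field r" for c
  proof -
    obtain a where a: "a \<in> Field r" "c \<in> underS r a" using exists_greater[OF c] .
    then have "x |` underS r a \<in> address_tree" using x by (simp add: branches_def)
    then obtain y a' where y: "x |` underS r a = address y |` underS r a'" "y \<in> topspace X"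
      unfolding address_tree_def by blast
    have "dom (x |` underS r a) = underS r a"
      using x underS_in_Field by (auto simp: branches_def full_seqs_def)
    then have "underS r a' = underS r a" using y(1) dom_address_restrict by metis
    then have "address y d = x d" if "d \<in> underS r a" for d
      using that y(1) by (metis restrict_in)
    then show ?thesis using a(2) y(2) underS_trans[OF _ a(2)] by blast
  qed
  then obtain y where y: "\<And>c. c \<in> Field r \<Longrightarrow> y c \<in> topspace X"
    "\<And>c. c \<in> Field r \<Longrightarrow> address (y c) c = x c"
    "\<And>c d. c \<in> Field r \<Longrightarrow> d \<in> underS r c \<Longrightarrow> address (y c) d = x d" by metis
  \<comment> \<open>Two of the points \<open>y c\<close> agree up to and including the smaller
    index, so these stages are coherent by \<open>stage_cong\<close>.\<close>
  define Z where "Z c = stage (y c) c" for c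
  have Z: "stage (y c) d = Z d" if c: "c \<in> Field r" and d: "d \<in> underS r c" for c d
  proof -
    have "d \<in> Field r" using underS_in_Field[OF d] by blast
    then show ?thesis
      unfolding Z_def using y c d underS_trans by (intro stage_cong) auto
  qed
  let ?S = "(\<lambda>c. fst (Z c)) ` Field r"
  have chain: "Complete_Partial_Order.chain (\<subseteq>\<^sub>m) ?S"
  proof (rule increasing_chain)
    show "fst (Z d) \<subseteq>\<^sub>m fst (Z c)" if "c \<in> Field r" "d \<in> underS r c" for c d
      using stage_increasing(1)[OF y(1)[OF that(1)] that] Z[OF that] by (simp add: Z_def)
  qed simp
  have run: "is_run h" if "h \<in> ?S" for h
    using that stage_good y(1) by (auto simp: Z_def good_def position_def)
  \<comment> \<open>Later stages have strictly longer plays, so no round is the last.\<close>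
  have "limit_segment r (dom (map_Sup ?S))"
    unfolding limit_segment_def
  proof (intro conjI ballI)
    show "Order_Relation.ofilter r (dom (map_Sup ?S))"
      using is_run_map_Sup[OF chain run] by (simp add: is_run_def)
    have "dom (fst (Z c)) \<noteq> {}" if "c \<in> Field r" for c
      using stage_extension[OF y(1)[OF that] that] map_le_implies_dom_le[of "fst (before (y c) c)" "fst (Z c)"]
      by (auto simp: Z_def extension_def)
    moreover obtain c where "c \<in> Field r" using infinite_Field by fastforce
    ultimately show "dom (map_Sup ?S) \<noteq> {}"
      unfolding dom_map_Sup[OF chain] by blast
  next
    fix a assume "a \<in> dom (map_Sup ?S)"
    then obtain c where c: "c \<in> Field r" "a \<in> dom (fst (Z c))"
      unfolding dom_map_Sup[OF chain] by blast
    obtain c' where c': "c' \<in> Field r" "c \<in> underS r c'" using exists_greater[OF c(1)] .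
    have "dom (fst (Z c)) \<subset> dom (fst (Z c'))"
      using stage_increasing(2)[OF y(1)[OF c'(1)] c'] Z[OF c'] by (simp add: Z_def)
    then obtain b where b: "b \<in> dom (fst (Z c'))" "b \<notin> dom (fst (Z c))" by blast
    have ofilter: "Order_Relation.ofilter r (dom (fst (Z c)))" if "c \<in> Field r" for c
      using run that by (auto simp: is_run_def)
    have "a \<in> Field r" "b \<in> Field r"
      using ofilter c c' b by (auto simp: Order_Relation.ofilter_def)
    then have "a \<in> underS r b"
      using total[of a b] ofilter_underS_mem[OF ofilter[OF c(1)] c(2), of b] b(2) c(2) by blast
    moreover have "b \<in> dom (map_Sup ?S)"
      unfolding dom_map_Sup[OF chain] using b(1) c'(1) by blast
    ultimately show "\<exists>b\<in>dom (map_Sup ?S). a \<noteq> b \<and> (a, b) \<in> r"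
      by (auto simp: underS_def)
  qed
  then have "core (map_Sup ?S) \<noteq> {}"
    by (intro limit_run_core_nonempty is_run_map_Sup chain run)
  then obtain z where "z \<in> core (map_Sup ?S)" by blast
  then have z: "z \<in> topspace X" "\<And>c. c \<in> Field r \<Longrightarrow> z \<in> core (fst (Z c))"
    unfolding core_map_Sup[OF chain] by auto
  \<comment> \<open>The play of the later stage \<open>c'\<close> has shrunk into all pieces before
    \<open>c'\<close>, among them the piece of stage \<open>c\<close>.\<close>
  have mem: "z \<in> snd (Z c)" if c: "c \<in> Field r" for c
  proof -
    obtain c' where c': "c' \<in> Field r" "c \<in> underS r c'" using exists_greater[OF c] .
    have "z \<in> snd (before (y c') c')"
      using z(2)[OF c'(1)] stage_core[OF y(1)[OF c'(1)] c'(1)] by (auto simp: Z_def)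
    then show ?thesis using before_upper[OF c'(2), of "y c'"] Z[OF c'] by auto
  qed
  \<comment> \<open>Lying in every piece forces \<open>z\<close> to choose the indices of
    \<open>x\<close> one after another.\<close>
  have "address z b = x b \<and> stage z b = Z b" if "b \<in> Field r" for b
    using that
  proof (induction b rule: ordinal_induct)
    case (less b)
    have "stage z c = stage (y b) c" if "c \<in> underS r b" for c
      using less.IH[OF that] Z[OF less.hyps that] by simp
    moreover have "z \<in> snd (stage (y b) b)" using mem[OF less.hyps] by (simp add: Z_def)
    ultimately have "address z b = address (y b) b \<and> stage z b = stage (y b) b"
      using y(1) z(1) less.hyps by (intro address_eqI) auto
    then show ?case using y(2)[OF less.hyps] by (simp add: Z_def)
  qed
  moreover have "address z b = x b" if "b \<notin> Field r" for b
  proof -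
    have "dom x = Field r" using x by (simp add: branches_def full_seqs_def)
    then have "x b = None" using that by blast
    then show ?thesis using that by (simp add: address_def)
  qed
  ultimately have "address z = x" by blast
  then show "x \<in> address ` topspace X" using z(1) by blast
qed

section \<open>Inverting the address map\<close>

lemma bij_betw_address: "bij_betw address (topspace X) (branches r address_tree)"
  using address_inj address_in_branches branches_subset by (auto simp: bij_betw_def)

text \<open>The topspace of a generated topology is only the union of the generating sets, so the
  branches have to be covered by basic neighbourhoods.\<close>

lemma topspace_branch_space: "topspace (branch_space r address_tree) = branches r address_tree"
proof -
  have "x \<in> \<Union>(basic_nbhd r ` seqs_below r)" if "x \<in> branches r address_tree" for x
  proof -
    obtain a where a: "a \<in> Field r" using infinite_Field by (metis finite.emptyI ex_in_conv)
    have "x |` underS r a \<in> seqs_below r" using that a address_tree_subset by (auto simp: branches_def)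
    moreover have "x \<in> basic_nbhd r (x |` underS r a)"
      using that by (auto simp: basic_nbhd_def branches_def map_le_def)
    ultimately show ?thesis by blast
  qed
  then show ?thesis
    unfolding branch_space_def bounded_topology_def
    by (auto simp: topspace_subtopology)
qed

text \<open>Some stage of the image point has its piece inside \<open>U\<close>, and this stage is
  determined by an initial segment of the branch. All branches sharing the segment are mapped into
  that piece.\<close>

lemma continuous_map_inv_address:
  "continuous_map (branch_space r address_tree) X (the_inv_into (topspace X) address)" (is "continuous_map _ _ ?f")
  unfolding continuous_map_def topspace_branch_space
proof (intro conjI allI impI)
  have f: "?f x \<in> topspace X \<and> address (?f x) = x" if "x \<in> branches r address_tree" for x
    using that bij_betw_address bij_betw_the_inv_into[OF bij_betw_address]
    by (metis bij_betw_apply f_the_inv_into_f_bij_betw)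
  then show "?f \<in> branches r address_tree \<rightarrow> topspace X" by blast
  fix U assume U: "openin X U"
  show "openin (branch_space r address_tree) {x \<in> branches r address_tree. ?f x \<in> U}"
  proof (subst openin_subopen, intro ballI)
    fix x assume x: "x \<in> {x \<in> branches r address_tree. ?f x \<in> U}"
    obtain b where b: "b \<in> Field r" "snd (stage (?f x) b) \<subseteq> U"
      using stage_within[OF U, of "?f x"] x by blast
    \<comment> \<open>The segment must include the value at \<open>b\<close> itself, so it is cut at
      a greater \<open>a\<close>.\<close>
    obtain a where a: "a \<in> Field r" "b \<in> underS r a" using exists_greater[OF b(1)] .
    let ?s = "x |` underS r a"
    let ?N = "basic_nbhd r ?s \<inter> branches r address_tree"
    have "?s \<in> seqs_below r" using x a(1) address_tree_subset by (auto simp: branches_def)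
    then have "openin (bounded_topology r) (basic_nbhd r ?s)"
      unfolding bounded_topology_def by (intro topology_generated_by_Basis imageI)
    then have "openin (branch_space r address_tree) ?N"
      unfolding branch_space_def openin_subtopology by blast
    moreover have "x \<in> ?N" using x by (auto simp: basic_nbhd_def branches_def map_le_def)
    moreover have "?N \<subseteq> {x \<in> branches r address_tree. ?f x \<in> U}"
    proof
      fix x' assume x': "x' \<in> ?N"
      have "dom x = Field r" using x by (simp add: branches_def full_seqs_def)
      then have agree: "x' d = x d" if "d \<in> underS r a" for d
        using x' that underS_in_Field[OF that] by (auto simp: basic_nbhd_def map_le_def)
      have "stage (?f x) b = stage (?f x') b"
        using b(1) agree a(2) underS_trans[OF _ a(2)] f x x' by (intro stage_cong) auto
      then have "?f x' \<in> snd (stage (?f x) b)" using stage_mem[OF _ b(1), of "?f x'"] f x' by auto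
      then show "x' \<in> {x \<in> branches r address_tree. ?f x \<in> U}" using b(2) x' by blast
    qed
    ultimately show "\<exists>N. openin (branch_space r address_tree) N \<and> x \<in> N \<and> N \<subseteq> {x \<in> branches r address_tree. ?f x \<in> U}"
      by blast
  qed
qed

end

section \<open>Choice of the splittings and conclusion\<close>

theorem theorem3p3:
  fixes r :: "'k rel" and X :: "'a topology"
  assumes "Card_order r" and "uncountable (Field r)" and "regularCard r"
    and "|seqs_below r| =o r"
    and "strong_Choquet r X"
    and "Hausdorff_space X" and "regular_space X" and "weight_le X r"
  shows "\<exists>T f. subtree r T \<and> no_end_nodes T \<and>
           continuous_map (branch_space r T) X f \<and>
           bij_betw f (branches r T) (topspace X)"
proof -
  obtain \<sigma> where \<sigma>: "winning_strategy_II X r \<sigma>"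
    using assms(5) unfolding strong_Choquet_def by blast
  interpret choquet_game r X \<sigma>
    using assms(1-3) \<sigma> by unfold_locales
  obtain e where e: "\<forall>i\<in>Field r. openin X (e i)"
    "\<forall>U y. openin X U \<longrightarrow> y \<in> U \<longrightarrow> (\<exists>i\<in>Field r. y \<in> e i \<and> e i \<subseteq> U)"
    using weight_le_basis[OF assms(8)] .
  obtain B where B: "\<forall>U y. openin X\<^sub>a U \<longrightarrow> y \<in> U \<longrightarrow> (\<exists>i\<in>Field r. y \<in> B i \<and> B i \<subseteq> U)"
    using additive_basis[OF assms(4,8)] .
  obtain K G where KG: "\<forall>b\<in>Field r. closedin X (K b) \<and> openin X (G b) \<and> K b \<subseteq> G b"
    "\<forall>U y. openin X U \<longrightarrow> y \<in> U \<longrightarrow> (\<exists>b\<in>Field r. y \<in> K b \<and> G b \<subseteq> U)"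
    using nested_pair_basis[OF assms(8,7)] .
  \<comment> \<open>\<open>exists_splitting\<close> justifies the choice for good nodes and
    \<open>b\<close> below \<kappa>; elsewhere the value is arbitrary.\<close>
  define split where "split s b = (SOME f. splitting (fst s) (snd s) (K b) (G b) f)" for s b
  interpret choquet_scheme r X \<sigma> K G split
  proof
    show "splitting (fst s) (snd s) (K b) (G b) (split s b)"
      if "good (fst s) (snd s)" "b \<in> Field r" for s b
      unfolding split_def
      using e B KG that(2)
      by (intro someI_ex[OF exists_splitting[where e = e and B = B, OF that(1) assms(7)]]) simp_all
  qed (use assms(6) KG(2) in auto)
  have "bij_betw (the_inv_into (topspace X) address) (branches r address_tree) (topspace X)"
    using bij_betw_the_inv_into[OF bij_betw_address] .
  then show ?thesis
    using subtree_address_tree no_end_nodes_address_tree continuous_map_inv_address by blast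
qed

end
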